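(* Let $\Phi$ be an LWR frame and assume that $\Phi$ is not flat. For any $z$-independent simple factor $g$, there exists a unique $z$-dependent simple factor $h$ such that $$g\#\Phi:=g\,\Phi\,h^{-1}$$ is an LWR frame.
   Context: LWR potential on a Riemann surface $\Sigma$ with local coordinate $z$: family $\xi_\lambda$ ($\lambda\in\mathbb C$) of meromorphic $\mathrm{sl}_2\mathbb C$-valued 1-forms, locally away from poles $\xi_\lambda=(A\lambda+B)dz$ with $A,B$ holomorphic in $z$ and independent of $\lambda$, $A$ nilpotent. LWR frame: a family of $\mathrm{SL}_2\mathbb C$-valued maps $\Phi_\lambda$, holomorphic in $z$ and in $\lambda\in\mathbb C$, such that $\Phi^{-1}d\Phi$ is an LWR potential. A spinor for $\xi$ is a (local) function $w=(a,b)$ with $A=ww^\perp$, $w^\perp=(-b\ \ a)$. The frame $\Phi$ is not flat if the Hopf differential of the surfaces it induces is not identically zero; equivalently, $\det(\Phi_\lambda w,(\Phi_\lambda w)_z)$ (which does not depend on $\lambda$) is not identically zero. Simple factor: for $\alpha\in\mathbb C$ and $\ell\neq m\in\mathbb CP^1$ (lines in $\mathbb C^2$), $\mathrm{SF}(\alpha,\ell,m):=S\Delta S^{-1}$ is the $\lambda$-family of $2\times2$ matrices with $\Delta=\begin{pmatrix}\lambda-\alpha&0\\0&1\end{pmatrix}$ and $S\in \mathrm{GL}_2\mathbb C$ independent of $\lambda$ with first column in $\ell$ and second column in $m$. It is $z$-independent if its data do not depend on $z$, and $z$-dependent if they are allowed to depend on $z$.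
   Formalization: The factor h is obtained, and g#Φ is an LWR frame, only off a closed discrete set of points (the dressed frame is meromorphic there), since the two lines of h can coincide at isolated points; uniqueness means agreement wherever both factors are defined. *)

theory Defs
  imports "HOL-Complex_Analysis.Complex_Analysis"
begin

section \<open>Riemann surfaces\<close>

text \<open>The surface is the whole type \<open>'a\<close>. A chart is a pair of its domain and its coordinate
  function; the values of the coordinate function outside the domain are irrelevant.\<close>

type_synonym 'a chart = "'a set \<times> ('a \<Rightarrow> complex)"

definition in_coord :: "'a chart \<Rightarrow> ('a \<Rightarrow> complex) \<Rightarrow> complex \<Rightarrow> complex" where
  "in_coord c f = (\<lambda>t. f (inv_into (fst c) (snd c) t))"

definition riemann_surface :: "'a::t2_space chart set \<Rightarrow> bool" where
  "riemann_surface At \<longleftrightarrow>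
     connected (UNIV :: 'a set) \<and>
     (\<Union>c\<in>At. fst c) = UNIV \<and>
     (\<forall>c\<in>At. open (fst c) \<and> open (snd c ` fst c) \<and>
        homeomorphism (fst c) (snd c ` fst c) (snd c) (inv_into (fst c) (snd c))) \<and>
     (\<forall>c\<in>At. \<forall>d\<in>At. in_coord c (snd d) holomorphic_on snd c ` (fst c \<inter> fst d))"

definition holo_in_chart :: "'a chart \<Rightarrow> 'a set \<Rightarrow> ('a \<Rightarrow> complex) \<Rightarrow> bool" where
  "holo_in_chart c V f \<longleftrightarrow> in_coord c f holomorphic_on snd c ` (fst c \<inter> V)"

definition mero_in_chart :: "'a chart \<Rightarrow> ('a \<Rightarrow> complex) \<Rightarrow> bool" where
  "mero_in_chart c f \<longleftrightarrow> in_coord c f meromorphic_on snd c ` fst c"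

text \<open>The derivative \<open>f\<^sub>z\<close> with respect to the coordinate \<open>z\<close> of the chart \<open>c\<close>, at the point \<open>x\<close>.\<close>

definition dz :: "'a chart \<Rightarrow> ('a \<Rightarrow> complex) \<Rightarrow> 'a \<Rightarrow> complex" where
  "dz c f x = deriv (in_coord c f) (snd c x)"

definition dz_vec :: "'a chart \<Rightarrow> ('a \<Rightarrow> complex^2) \<Rightarrow> 'a \<Rightarrow> complex^2" where
  "dz_vec c f x = (\<chi> i. dz c (\<lambda>y. f y $ i) x)"

definition dz_mat :: "'a chart \<Rightarrow> ('a \<Rightarrow> complex^2^2) \<Rightarrow> 'a \<Rightarrow> complex^2^2" where
  "dz_mat c F x = (\<chi> i j. dz c (\<lambda>y. F y $ i $ j) x)"


section \<open>LWR potentials and frames\<close>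

definition scale_mat :: "complex \<Rightarrow> complex^2^2 \<Rightarrow> complex^2^2" where
  "scale_mat s M = (\<chi> i j. s * M $ i $ j)"

definition nilpotent_mat :: "complex^2^2 \<Rightarrow> bool" where
  "nilpotent_mat M \<longleftrightarrow> (\<exists>k. (((**) M) ^^ k) (mat 1) = 0)"

text \<open>A \<open>\<lambda>\<close>-family of matrix-valued 1-forms is given by its coefficients: in the chart \<open>c\<close> with
  coordinate \<open>z\<close>, the form with parameter \<open>l\<close> is \<open>\<xi> c x l dz\<close> at the point \<open>x\<close>.\<close>

type_synonym 'a mform = "'a chart \<Rightarrow> 'a \<Rightarrow> complex \<Rightarrow> complex^2^2"

text \<open>The set \<open>P\<close> contains the poles. It is closed and discrete, since \<open>P sparse_in UNIV\<close> says
  that \<open>P\<close> has no limit points on the surface. Values at points of \<open>P\<close> are irrelevant.\<close>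

definition lwr_potential :: "'a::t2_space chart set \<Rightarrow> 'a set \<Rightarrow> 'a mform \<Rightarrow> bool" where
  "lwr_potential At P \<xi> \<longleftrightarrow>
     P sparse_in UNIV \<and>
     (\<forall>c\<in>At. \<forall>d\<in>At. \<forall>x \<in> fst c \<inter> fst d - P. \<forall>l.
        \<xi> c x l = scale_mat (dz c (snd d) x) (\<xi> d x l)) \<and>
     (\<forall>c\<in>At. \<forall>x \<in> fst c - P. \<forall>l. trace (\<xi> c x l) = 0) \<and>
     (\<forall>c\<in>At. \<exists>A B :: 'a \<Rightarrow> complex^2^2.
        (\<forall>i j. holo_in_chart c (- P) (\<lambda>x. A x $ i $ j) \<and> mero_in_chart c (\<lambda>x. A x $ i $ j)) \<and>
        (\<forall>i j. holo_in_chart c (- P) (\<lambda>x. B x $ i $ j) \<and> mero_in_chart c (\<lambda>x. B x $ i $ j)) \<and>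
        (\<forall>x \<in> fst c - P. nilpotent_mat (A x)) \<and>
        (\<forall>x \<in> fst c - P. \<forall>l. \<xi> c x l = scale_mat l (A x) + B x))"

text \<open>The form \<open>\<Phi>\<^sup>-\<^sup>1 d\<Phi>\<close>.\<close>

definition maurer_cartan :: "('a \<Rightarrow> complex \<Rightarrow> complex^2^2) \<Rightarrow> 'a mform" where
  "maurer_cartan \<Phi> c x l = matrix_inv (\<Phi> x l) ** dz_mat c (\<lambda>y. \<Phi> y l) x"

text \<open>An LWR frame on the surface, holomorphic off the closed discrete set \<open>P\<close> and meromorphic
  at the points of \<open>P\<close>. For \<open>P = {}\<close> it is a holomorphic frame on the whole surface.\<close>

definition lwr_frame ::
    "'a::t2_space chart set \<Rightarrow> 'a set \<Rightarrow> ('a \<Rightarrow> complex \<Rightarrow> complex^2^2) \<Rightarrow> bool" where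
  "lwr_frame At P \<Phi> \<longleftrightarrow>
     P sparse_in UNIV \<and>
     (\<forall>x \<in> - P. \<forall>l. det (\<Phi> x l) = 1) \<and>
     (\<forall>c\<in>At. \<forall>l i j. holo_in_chart c (- P) (\<lambda>x. \<Phi> x l $ i $ j) \<and>
                      mero_in_chart c (\<lambda>x. \<Phi> x l $ i $ j)) \<and>
     (\<forall>x \<in> - P. \<forall>i j. (\<lambda>l. \<Phi> x l $ i $ j) holomorphic_on UNIV) \<and>
     lwr_potential At P (maurer_cartan \<Phi>)"


section \<open>Spinors and flatness\<close>

definition perp :: "complex^2 \<Rightarrow> complex^2" where
  "perp w = vector [- (w $ 2), w $ 1]"

text \<open>A local spinor \<open>w\<close> on the open subset \<open>V\<close> of the domain of \<open>c\<close>: the coefficient of \<open>l\<close>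
  in \<open>\<xi>\<close> is the column \<open>w\<close> times the row \<open>perp w\<close>.\<close>

definition spinor ::
    "'a::topological_space mform \<Rightarrow> 'a chart \<Rightarrow> 'a set \<Rightarrow> ('a \<Rightarrow> complex^2) \<Rightarrow> bool" where
  "spinor \<xi> c V w \<longleftrightarrow>
     open V \<and> V \<subseteq> fst c \<and>
     (\<forall>i. holo_in_chart c V (\<lambda>x. w x $ i)) \<and>
     (\<exists>B. \<forall>x\<in>V. \<forall>l. \<xi> c x l = scale_mat l (\<chi> i j. w x $ i * perp (w x) $ j) + B x)"

text \<open>The determinant of the matrix with columns \<open>\<Phi>w\<close> and \<open>(\<Phi>w)\<^sub>z\<close> vanishes identically.\<close>

definition lwr_flat ::
    "'a::t2_space chart set \<Rightarrow> 'a set \<Rightarrow> ('a \<Rightarrow> complex \<Rightarrow> complex^2^2) \<Rightarrow> bool" where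
  "lwr_flat At P \<Phi> \<longleftrightarrow>
     (\<forall>c\<in>At. \<forall>V w. V \<subseteq> - P \<and> spinor (maurer_cartan \<Phi>) c V w \<longrightarrow>
        (\<forall>x\<in>V. \<forall>l. let u = (\<lambda>y. \<Phi> y l *v w y)
                   in det (transpose (vector [u x, dz_vec c u x] :: complex^2^2)) = 0))"


section \<open>Simple factors\<close>

definition CP1 :: "(complex^2) set set" where
  "CP1 = {L. vec.subspace L \<and> vec.dim L = 1}"

definition is_SF ::
    "complex \<Rightarrow> (complex^2) set \<Rightarrow> (complex^2) set \<Rightarrow> (complex \<Rightarrow> complex^2^2) \<Rightarrow> bool" where
  "is_SF \<alpha> L M g \<longleftrightarrow>
     L \<in> CP1 \<and> M \<in> CP1 \<and> L \<noteq> M \<and>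
     (\<exists>S :: complex^2^2. invertible S \<and> column 1 S \<in> L \<and> column 2 S \<in> M \<and>
        (\<forall>l. g l = S ** vector [vector [l - \<alpha>, 0], vector [0, 1]] ** matrix_inv S))"

definition simple_factor :: "(complex \<Rightarrow> complex^2^2) \<Rightarrow> bool" where
  "simple_factor g \<longleftrightarrow> (\<exists>\<alpha> L M. is_SF \<alpha> L M g)"

text \<open>All the data of a \<open>z\<close>-dependent simple factor, including \<open>\<alpha>\<close>, may vary with the point.\<close>

definition z_dependent_simple_factor ::
    "'a set \<Rightarrow> ('a \<Rightarrow> complex \<Rightarrow> complex^2^2) \<Rightarrow> bool" where
  "z_dependent_simple_factor V h \<longleftrightarrow>
     (\<exists>\<alpha> L M. \<forall>x\<in>V. is_SF (\<alpha> x) (L x) (M x) (h x))"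

text \<open>\<open>g \<Phi> h\<^sup>-\<^sup>1\<close> is an LWR frame. It is meromorphic on the surface, so a larger singular set
  \<open>Q\<close> is admitted: the two lines of \<open>h\<close> may coincide at isolated points, where \<open>h\<close> is undefined.
  As \<open>h x l\<close> is singular at the one value \<open>l = \<alpha>\<close>, the product is defined for the other
  values of \<open>l\<close>, and \<open>\<Psi>\<close> is its (unique) holomorphic extension to all \<open>l\<close>.\<close>

definition dresses_to_lwr_frame ::
    "'a::t2_space chart set \<Rightarrow> 'a set \<Rightarrow> ('a \<Rightarrow> complex \<Rightarrow> complex^2^2) \<Rightarrow>
     (complex \<Rightarrow> complex^2^2) \<Rightarrow> 'a set \<Rightarrow> ('a \<Rightarrow> complex \<Rightarrow> complex^2^2) \<Rightarrow> bool" where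
  "dresses_to_lwr_frame At P \<Phi> g Q h \<longleftrightarrow>
     P \<subseteq> Q \<and>
     (\<exists>\<Psi>. lwr_frame At Q \<Psi> \<and>
        (\<forall>x \<in> - Q. \<forall>l. invertible (h x l) \<longrightarrow>
           \<Psi> x l = g l ** \<Phi> x l ** matrix_inv (h x l)))"

end

theory Submission
  imports Defs
begin

text \<open>
  Fix a coordinate and write \<open>\<mu> = \<lambda> - \<alpha>\<close>, where \<open>\<alpha>\<close> is the spectral value of \<open>g\<close>. The potential
  of \<open>\<Phi>\<close> is \<open>\<xi> = \<mu> A + C\<close>, and \<open>g\<close> has eigenvectors \<open>v0\<close> and \<open>m0\<close> with eigenvalues \<open>\<mu>\<close> and \<open>1\<close>.
  Put \<open>G = g \<Phi>\<close>.

  The dressing factor is forced. If \<open>G = \<Omega> h\<close> with a frame \<open>\<Omega>\<close>, then at \<open>\<lambda> = \<alpha>\<close> the first line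
  of \<open>h\<close> is the kernel of \<open>G\<close>, spanned by \<open>v = \<Phi>\<^sub>\<alpha>\<^sup>-\<^sup>1 v0\<close>. The condition that the potential of \<open>\<Omega>\<close> is
  affine in \<open>\<lambda>\<close> with nilpotent linear term then forces the second line to be the kernel of \<open>A\<close>,
  spanned by \<open>w = A v\<close> (\<open>h_unique\<close>). This determines \<open>h\<close> wherever \<open>v\<close> and \<open>w\<close> are independent. For a
  spinor \<open>s\<close> one has \<open>det (v, w) = - det (v, s)\<^sup>2\<close>, and if this vanished on an open set, differentiating
  \<open>det (v, s) = 0\<close> would show that the frame is flat there. As the surface is connected and the
  determinant is meromorphic, its zeros are closed and discrete (\<open>Q_sparse_of_not_flat\<close>).

  Conversely, let \<open>h\<close> have eigenvectors \<open>v\<close> and \<open>w\<close> with eigenvalues \<open>\<mu>\<close> and \<open>1\<close>. The frame \<open>\<Psi> = G h\<^sup>-\<^sup>1\<close>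
  maps \<open>v\<close> to \<open>u = G v / \<mu>\<close>, which is entire in \<open>\<lambda>\<close> because \<open>G v\<close> vanishes at \<open>\<mu> = 0\<close>, and \<open>w\<close> to
  \<open>G w\<close>. From \<open>v' = - C v\<close> and \<open>A w = 0\<close> one gets
  \<open>u' = G w\<close> and \<open>(G w)' = \<mu> b u + d G w\<close>, where \<open>w' + C w = b v + d w\<close>.
  The parameter enters this linear system through one entry only, and translating back, the
  potential of \<open>\<Psi>\<close> at \<open>\<lambda>\<close> is \<open>\<xi>\<close> at \<open>\<alpha> + 1\<close> plus \<open>(\<mu> - 1) A'\<close>, where \<open>A'\<close> kills \<open>v\<close> and sends \<open>w\<close> to
  \<open>b v\<close>; so \<open>A'\<close> is nilpotent (\<open>maurer_cartan_\<Psi>\<close>).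

  The delicate point is \<open>\<lambda> = \<alpha>\<close>, where \<open>u\<close> is a derivative in the parameter. A frame is holomorphic
  in the coordinate and in \<open>\<lambda>\<close> separately, and meromorphic at its poles for each \<open>\<lambda>\<close> separately, with
  no uniformity assumed. The linear system supplies it: solutions are bounded near a point uniformly
  in \<open>\<lambda>\<close>, and Montel's theorem gives \<open>u' = G w\<close> in the limit (\<open>derivative_of_pointwise_limit\<close>); at a
  pole \<open>u\<close> is a primitive of a meromorphic function, hence meromorphic (\<open>meromorphic_primitive\<close>).
\<close>

(* The same sign denotes the coefficients of a formal power series; with both readings the number
   of parses of an expression grows exponentially with the number of vector components in it. *)
no_notation fps_nth (infixl \<open>$\<close> 75)

section \<open>Vectors and matrices in the plane\<close>

definition cross2 :: "complex^2 \<Rightarrow> complex^2 \<Rightarrow> complex" where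
  "cross2 a b = a $ 1 * b $ 2 - a $ 2 * b $ 1"

text \<open>The matrix that sends the basis \<open>a, b\<close> to \<open>a', b'\<close>, with the coordinates in that basis
  written by Cramer's rule. All frames and factors below are described by such images; the
  explicit quotient makes it visible that their entries are meromorphic.\<close>

definition basis_map ::
    "complex^2 \<Rightarrow> complex^2 \<Rightarrow> complex^2 \<Rightarrow> complex^2 \<Rightarrow> complex^2^2" where
  "basis_map a b a' b' = (\<chi> i j. (a' $ i * cross2 (axis j 1) b + b' $ i * cross2 a (axis j 1)) / cross2 a b)"

lemma vec2_eq_iff: "a = b \<longleftrightarrow> a $ 1 = b $ 1 \<and> a $ 2 = b $ 2" for a b :: "'a^2"
  by (simp add: vec_eq_iff forall_2)

lemma mult_vec2: "(M *v a) $ i = M $ i $ 1 * a $ 1 + M $ i $ 2 * a $ 2" for M :: "complex^2^2"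
  by (simp add: matrix_vector_mult_def sum_2)

lemma mult_mat2: "(M ** N) $ i $ j = M $ i $ 1 * N $ 1 $ j + M $ i $ 2 * N $ 2 $ j"
  for M :: "complex^2^2"
  by (simp add: matrix_matrix_mult_def sum_2)

lemma axis2 [simp]:
  "axis (1::2) x $ 1 = x" "axis (1::2) x $ 2 = 0" "axis (2::2) x $ 1 = 0" "axis (2::2) x $ 2 = x"
  by (simp_all add: axis_def)

lemma scale_mat_mult_vec: "scale_mat s M *v a = s *s (M *v a)"
  by (simp add: vec2_eq_iff mult_vec2 scale_mat_def algebra_simps)

lemma cross2_simps [simp]: "cross2 a a = 0" "cross2 0 a = 0" "cross2 a 0 = 0"
  by (simp_all add: cross2_def)

lemma cross2_add: "cross2 (a + a') b = cross2 a b + cross2 a' b" "cross2 a (b + b') = cross2 a b + cross2 a b'"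
  by (simp_all add: cross2_def algebra_simps)

lemma cross2_smult: "cross2 (s *s a) b = s * cross2 a b" "cross2 a (s *s b) = s * cross2 a b"
  by (simp_all add: cross2_def algebra_simps)

lemma cross2_mult: "cross2 (M *v a) (M *v b) = det M * cross2 a b"
  by (simp add: cross2_def mult_vec2 det_2 algebra_simps)

text \<open>Infinitesimal form of \<open>cross2_mult\<close>: a trace-free matrix is tangent to the group that preserves
  areas.\<close>

lemma cross2_trace:
  assumes "trace M = 0"
  shows "cross2 (M *v a) b + cross2 a (M *v b) = 0"
proof -
  have "M $ 2 $ 2 = - M $ 1 $ 1"
    using assms by (simp add: trace_def sum_2 add_eq_0_iff)
  then show ?thesis
    by (simp add: cross2_def mult_vec2 algebra_simps)
qed

lemma cross2_eq_0_imp_parallel: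
  assumes "cross2 a b = 0" "a \<noteq> 0"
  obtains k where "b = k *s a"
proof (cases "a $ 1 = 0")
  case True
  then have "a $ 2 \<noteq> 0" using assms(2) by (auto simp: vec2_eq_iff)
  then have "b = (b $ 2 / a $ 2) *s a"
    using True assms(1) by (simp add: vec2_eq_iff cross2_def)
  then show ?thesis using that by blast
next
  case False
  then have "b = (b $ 1 / a $ 1) *s a"
    using assms(1) by (simp add: vec2_eq_iff cross2_def field_simps)
  then show ?thesis using that by blast
qed

lemma cross2_expansion: "cross2 a b *s z = cross2 z b *s a + cross2 a z *s b"
  by (simp add: vec2_eq_iff cross2_def algebra_simps)

lemma basis_decomposition:
  assumes "cross2 a b \<noteq> 0"
  shows "z = (cross2 z b / cross2 a b) *s a + (cross2 a z / cross2 a b) *s b"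
  using cross2_expansion[of a b z] assms
  by (simp add: vec2_eq_iff field_simps)

lemma basis_map_apply:
  assumes "cross2 a b \<noteq> 0"
  shows "basis_map a b a' b' *v a = a'" "basis_map a b a' b' *v b = b'"
proof -
  have *: "cross2 (axis 1 1) b * a $ 1 + cross2 (axis 2 1) b * a $ 2 = cross2 a b"
          "cross2 a (axis 1 1) * a $ 1 + cross2 a (axis 2 1) * a $ 2 = 0"
          "cross2 (axis 1 1) b * b $ 1 + cross2 (axis 2 1) b * b $ 2 = 0"
          "cross2 a (axis 1 1) * b $ 1 + cross2 a (axis 2 1) * b $ 2 = cross2 a b"
    by (simp_all add: cross2_def algebra_simps)
  have "(basis_map a b a' b' *v a) $ i = 
     (a' $ i * (cross2 (axis 1 1) b * a $ 1 + cross2 (axis 2 1) b * a $ 2) + 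
      b' $ i * (cross2 a (axis 1 1) * a $ 1 + cross2 a (axis 2 1) * a $ 2)) / cross2 a b" for i
    by (simp add: mult_vec2 basis_map_def add_divide_distrib[symmetric] algebra_simps)
  then show "basis_map a b a' b' *v a = a'"
    unfolding * using assms by (simp add: vec_eq_iff)
  have "(basis_map a b a' b' *v b) $ i = 
     (a' $ i * (cross2 (axis 1 1) b * b $ 1 + cross2 (axis 2 1) b * b $ 2) + 
      b' $ i * (cross2 a (axis 1 1) * b $ 1 + cross2 a (axis 2 1) * b $ 2)) / cross2 a b" for i
    by (simp add: mult_vec2 basis_map_def add_divide_distrib[symmetric] algebra_simps)
  then show "basis_map a b a' b' *v b = b'"
    unfolding * using assms by (simp add: vec_eq_iff)
qed

lemma matrix_eq_on_basis:
  fixes M N :: "complex^2^2"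
  assumes "cross2 a b \<noteq> 0" "M *v a = N *v a" "M *v b = N *v b"
  shows "M = N"
proof -
  have "M *v z = N *v z" for z
    by (subst (1 2) basis_decomposition[OF assms(1)])
       (simp add: matrix_vector_right_distrib vector_scalar_commute assms)
  then show ?thesis by (simp add: matrix_eq)
qed

lemma eq_basis_map:
  assumes "cross2 a b \<noteq> 0" "M *v a = a'" "M *v b = b'"
  shows "M = basis_map a b a' b'"
  by (rule matrix_eq_on_basis[OF assms(1)]) (simp_all only: basis_map_apply[OF assms(1)] assms)

text \<open>Only the line of \<open>b\<close> matters if \<open>b'\<close> is scaled along with it. This is what makes the dressing
  factor independent of the coordinate.\<close>

lemma basis_map_scale:
  assumes "t \<noteq> 0"
  shows "basis_map a (t *s b) a' (t *s b') = basis_map a b a' b'"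
proof -
  have "a' $ i * (t * x) + t * b' $ i * y = t * (a' $ i * x + b' $ i * y)" for i x y
    by (simp add: algebra_simps)
  then show ?thesis
    using assms by (simp add: basis_map_def vec_eq_iff cross2_smult)
qed

lemma det_basis_map:
  assumes "cross2 a b \<noteq> 0"
  shows "det (basis_map a b a' b') = cross2 a' b' / cross2 a b"
  using cross2_mult[of "basis_map a b a' b'" a b] basis_map_apply[OF assms] assms
  by (simp add: field_simps)

lemma trace_basis_map_shear:
  assumes "cross2 a b \<noteq> 0"
  shows "trace (basis_map a b 0 (s *s a)) = 0"
  by (simp add: trace_def sum_2 basis_map_def cross2_def flip: add_divide_distrib)

lemma invertible_matrix_inv:
  fixes M :: "complex^2^2"
  assumes "invertible M"
  shows "matrix_inv M ** M = mat 1" "M ** matrix_inv M = mat 1"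
proof -
  have "M ** matrix_inv M = mat 1 \<and> matrix_inv M ** M = mat 1"
    using assms unfolding invertible_def matrix_inv_def by (rule someI_ex)
  then show "matrix_inv M ** M = mat 1" "M ** matrix_inv M = mat 1" by auto
qed

lemma det_1_invertible: "det M = 1 \<Longrightarrow> invertible M" for M :: "complex^2^2"
  by (simp add: invertible_det_nz)

lemma det_1_mult_cancel:
  fixes M :: "complex^2^2"
  assumes "det M = 1" "M *v a = M *v b"
  shows "a = b"
proof -
  have "matrix_inv M *v (M *v a) = matrix_inv M *v (M *v b)" using assms(2) by simp
  then show ?thesis
    using invertible_matrix_inv(1)[OF det_1_invertible[OF assms(1)]]
    by (simp only: matrix_vector_mul_assoc matrix_vector_mul_lid)
qed

lemma mult_scale_mat: "M ** scale_mat s N = scale_mat s (M ** N)"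
  by (simp add: vec_eq_iff mult_mat2 scale_mat_def algebra_simps)

lemma trace2: "trace M = M $ 1 $ 1 + M $ 2 $ 2" for M :: "complex^2^2"
  by (simp add: trace_def sum_2)

lemma trace_scale_mat: "trace (scale_mat s M) = s * trace M"
  by (simp add: trace2 scale_mat_def distrib_left)

lemma nilpotent_eigenvalue:
  assumes "nilpotent_mat M" "M *v a = c *s a" "a \<noteq> 0"
  shows "c = 0"
proof -
  have *: "((((**) M) ^^ k) (mat 1)) *v a = c ^ k *s a" for k
    by (induction k)
       (auto simp: matrix_vector_mul_assoc[symmetric] vector_scalar_commute assms(2))
  obtain k where "(((**) M) ^^ k) (mat 1) = 0"
    using assms(1) by (auto simp: nilpotent_mat_def)
  with *[of k] assms(3) show ?thesis by auto
qed

text \<open>Nilpotency gives \<open>det M = 0\<close>, and by Cayley-Hamilton a trace-free matrix satisfies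
  \<open>M\<^sup>2 = - det M\<close>.\<close>

lemma nilpotent_trace_0_sq:
  assumes "nilpotent_mat M" "trace M = 0"
  shows "M *v (M *v a) = 0"
proof -
  obtain k where k: "(((**) M) ^^ k) (mat 1) = 0"
    using assms(1) by (auto simp: nilpotent_mat_def)
  have "det ((((**) M) ^^ k) (mat 1)) = det M ^ k" for k
    by (induction k) (auto simp: det_mul)
  from this[of k] k have "det M ^ k = 0" by (simp add: det_2)
  then have "det M = 0" by simp
  then have d: "M $ 1 $ 1 * M $ 2 $ 2 = M $ 1 $ 2 * M $ 2 $ 1" by (simp add: det_2)
  have t: "M $ 2 $ 2 = - M $ 1 $ 1"
    using assms(2) by (simp add: trace_def sum_2 add_eq_0_iff)
  from d t have s: "M $ 1 $ 1 * M $ 1 $ 1 = - (M $ 1 $ 2 * M $ 2 $ 1)"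
    by (metis minus_equation_iff mult_minus_right)
  have "(M *v (M *v a)) $ i = (M $ 1 $ 1 * M $ 1 $ 1 + M $ 1 $ 2 * M $ 2 $ 1) * a $ i" for i
    using exhaust_2[of i] by (auto simp: mult_vec2 t algebra_simps)
  then show ?thesis
    by (simp add: vec_eq_iff s)
qed

lemma sq_0_imp_nilpotent: "M ** M = 0 \<Longrightarrow> nilpotent_mat M"
  unfolding nilpotent_mat_def by (rule exI[of _ 2]) (simp add: numeral_2_eq_2)

lemma line_in_CP1: "a \<noteq> 0 \<Longrightarrow> vec.span {a} \<in> CP1"
  unfolding CP1_def using vec.dim_eq_card[of "{a}" "{a}"]
  by (simp add: vec.dim_span_eq_card_independent)

lemma diag_mult_axis:
  "(vector [vector [s, 0], vector [0, 1]] :: complex^2^2) *v axis 1 1 = s *s axis 1 1"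
  "(vector [vector [s, 0], vector [0, 1]] :: complex^2^2) *v axis 2 1 = axis 2 1"
  by (simp_all add: vec2_eq_iff mult_vec2)

text \<open>A simple factor is used only through its two eigenvectors, with eigenvalues \<open>l - \<alpha>\<close> and \<open>1\<close>.\<close>

lemma is_SF_eigenbasis:
  assumes "is_SF \<alpha> L M g"
  obtains a b where "cross2 a b \<noteq> 0" "\<And>l. g l *v a = (l - \<alpha>) *s a" "\<And>l. g l *v b = b"
proof -
  from assms obtain S :: "complex^2^2" where S: "invertible S"
    and g: "\<And>l. g l = S ** vector [vector [l - \<alpha>, 0], vector [0, 1]] ** matrix_inv S"
    unfolding is_SF_def by blast
  have e: "column 1 S = S *v axis 1 1" "column 2 S = S *v axis 2 1"
    by (simp_all add: vec_eq_iff column_def mult_vec2)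
  have "matrix_inv S *v (S *v z) = z" for z
    using invertible_matrix_inv(1)[OF S] by (simp add: matrix_vector_mul_assoc)
  then have gs: "g l *v (S *v z) = S *v (vector [vector [l - \<alpha>, 0], vector [0, 1]] *v z)" for l z
    by (simp add: g matrix_vector_mul_assoc[symmetric])
  show ?thesis
  proof (rule that)
    show "cross2 (column 1 S) (column 2 S) \<noteq> 0"
      using S unfolding e cross2_mult by (simp add: cross2_def invertible_det_nz)
    fix l
    show "g l *v column 1 S = (l - \<alpha>) *s column 1 S" "g l *v column 2 S = column 2 S"
      unfolding e gs by (simp_all only: diag_mult_axis vector_scalar_commute)
  qed
qed

lemma is_SF_basis_map:
  assumes "cross2 a b \<noteq> 0"
  shows "is_SF \<alpha> (vec.span {a}) (vec.span {b}) (\<lambda>l. basis_map a b ((l - \<alpha>) *s a) b)"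
proof -
  define S :: "complex^2^2" where "S = transpose (vector [a, b])"
  have S: "column 1 S = a" "column 2 S = b"
    by (simp_all add: S_def vec_eq_iff column_def transpose_def)
  have e: "S *v axis 1 1 = a" "S *v axis 2 1 = b"
    by (simp_all add: vec2_eq_iff S_def mult_vec2 transpose_def)
  have inv: "invertible S"
    using assms cross2_mult[of S "axis 1 1" "axis 2 1"]
    unfolding e by (simp add: invertible_det_nz)
  have nz: "a \<noteq> 0" "b \<noteq> 0" using assms by auto
  have "vec.span {a} \<noteq> vec.span {b}"
  proof
    assume "vec.span {a} = vec.span {b}"
    then have "b \<in> vec.span {a}" using vec.span_base by blast
    then obtain k where "b = k *s a" by (auto simp: vec.span_singleton)
    then show False using assms by (simp add: cross2_smult)
  qed
  moreover have "basis_map a b ((l - \<alpha>) *s a) b = 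
      S ** vector [vector [l - \<alpha>, 0], vector [0, 1]] ** matrix_inv S" (is "_ = ?R") for l
  proof (rule matrix_eq_on_basis[OF assms])
    have i: "matrix_inv S *v (S *v z) = z" for z
      using invertible_matrix_inv(1)[OF inv] by (simp add: matrix_vector_mul_assoc)
    have "?R *v (S *v axis 1 1) = (l - \<alpha>) *s (S *v axis 1 1)"
      by (simp only: matrix_vector_mul_assoc[symmetric] i diag_mult_axis vector_scalar_commute)
    then have "?R *v a = (l - \<alpha>) *s a" by (simp only: e)
    then show "basis_map a b ((l - \<alpha>) *s a) b *v a = ?R *v a"
      by (simp add: basis_map_apply assms)
    have "?R *v (S *v axis 2 1) = S *v axis 2 1"
      by (simp only: matrix_vector_mul_assoc[symmetric] i diag_mult_axis)
    then have "?R *v b = b" by (simp only: e)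
    then show "basis_map a b ((l - \<alpha>) *s a) b *v b = ?R *v b"
      by (simp add: basis_map_apply assms)
  qed
  ultimately show ?thesis
    unfolding is_SF_def using inv S nz by (auto simp: line_in_CP1 vec.span_base intro!: exI[of _ S])
qed

section \<open>Limits and primitives of holomorphic functions\<close>

lemma entire_agree_at:
  fixes F H :: "complex \<Rightarrow> complex"
  assumes "F holomorphic_on UNIV" "H holomorphic_on UNIV" "\<And>l. l \<noteq> \<alpha> \<Longrightarrow> F l = H l"
  shows "F \<alpha> = H \<alpha>"
proof -
  have "isCont F \<alpha>" "isCont H \<alpha>"
    using assms(1,2) holomorphic_on_imp_continuous_on continuous_on_eq_continuous_at by blast+
  then have "(F \<longlongrightarrow> F \<alpha>) (at \<alpha>)" "(H \<longlongrightarrow> H \<alpha>) (at \<alpha>)" by (auto simp: isCont_def)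
  moreover have "eventually (\<lambda>l. F l = H l) (at \<alpha>)"
    using assms(3) by (auto simp: eventually_at_filter)
  ultimately show ?thesis
    by (metis tendsto_cong LIM_unique)
qed

text \<open>A Gronwall estimate on a small disc: at a point where \<open>norm X + norm Y\<close> is maximal, the mean
  value inequality bounds it by its value at the centre plus at most half of itself.\<close>

lemma pair_bound:
  fixes X Y p q :: "complex \<Rightarrow> complex"
  assumes r: "r \<ge> 0" "r * (1 + K) \<le> 1 / 2"
    and X: "\<And>z. z \<in> cball z0 r \<Longrightarrow> (X has_field_derivative Y z) (at z)"
    and Y: "\<And>z. z \<in> cball z0 r \<Longrightarrow> (Y has_field_derivative p z * X z + q z * Y z) (at z)"
    and K: "\<And>z. z \<in> cball z0 r \<Longrightarrow> norm (p z) \<le> K" "\<And>z. z \<in> cball z0 r \<Longrightarrow> norm (q z) \<le> K"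
    and z: "z \<in> cball z0 r"
  shows "norm (X z) + norm (Y z) \<le> 2 * (norm (X z0) + norm (Y z0))"
proof -
  define N where "N = (\<lambda>z. norm (X z) + norm (Y z))"
  have z0: "z0 \<in> cball z0 r" using r by simp
  have "continuous_on (cball z0 r) N"
    unfolding N_def
    by (intro continuous_intros continuous_at_imp_continuous_on ballI)
       (use X Y DERIV_isCont in blast)+
  then obtain m where m: "m \<in> cball z0 r" "\<And>y. y \<in> cball z0 r \<Longrightarrow> N y \<le> N m"
    using continuous_attains_sup[of "cball z0 r" N] z0 by auto
  have K0: "K \<ge> 0" using K(1)[OF z0] norm_ge_zero order_trans by blast
  have Nm: "0 \<le> N m" by (simp add: N_def)
  have d: "norm (m - z0) \<le> r" using m(1) by (simp add: dist_norm norm_minus_commute)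
  have "norm (X m - X z0) \<le> N m * norm (m - z0)"
  proof (rule field_differentiable_bound[of "cball z0 r"])
    fix y assume y: "y \<in> cball z0 r"
    show "norm (Y y) \<le> N m"
      using m(2)[OF y] norm_ge_zero[of "X y"] unfolding N_def by linarith
  qed (use X m z0 in \<open>auto intro: has_field_derivative_at_within\<close>)
  also have "\<dots> \<le> N m * r" using d Nm by (rule mult_left_mono)
  finally have 1: "norm (X m - X z0) \<le> N m * r" .
  have "norm (Y m - Y z0) \<le> (K * N m) * norm (m - z0)"
  proof (rule field_differentiable_bound[of "cball z0 r"])
    fix y assume y: "y \<in> cball z0 r"
    have "norm (p y * X y + q y * Y y) \<le> K * norm (X y) + K * norm (Y y)"
      by (rule norm_triangle_le) 
         (auto simp: norm_mult intro!: add_mono mult_right_mono K y)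
    also have "\<dots> = K * N y" by (simp add: N_def algebra_simps)
    also have "\<dots> \<le> K * N m" using m(2)[OF y] K0 by (rule mult_left_mono)
    finally show "norm (p y * X y + q y * Y y) \<le> K * N m" .
  qed (use Y m z0 in \<open>auto intro: has_field_derivative_at_within\<close>)
  also have "\<dots> \<le> (K * N m) * r" using d Nm K0 by (intro mult_left_mono) auto
  finally have 2: "norm (Y m - Y z0) \<le> K * N m * r" .
  have "N m \<le> N z0 + (norm (X m - X z0) + norm (Y m - Y z0))"
    unfolding N_def using norm_triangle_sub[of "X m" "X z0"] norm_triangle_sub[of "Y m" "Y z0"] by simp
  also have "\<dots> \<le> N z0 + (r * (1 + K)) * N m"
    using 1 2 by (simp add: algebra_simps)
  also have "\<dots> \<le> N z0 + 1 / 2 * N m"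
    using mult_right_mono[OF r(2) Nm] by simp
  finally have "N m \<le> 2 * N z0" by simp
  then show ?thesis using m(2)[OF z] by (simp add: N_def)
qed

text \<open>Pointwise convergence alone would not allow differentiating the limit. The linear system gives,
  through \<open>pair_bound\<close>, a bound that is uniform in \<open>n\<close>; by Montel's theorem a subsequence
  then converges locally uniformly, and locally uniform limits may be differentiated. The lemma
  replaces joint regularity in the coordinate and the spectral parameter, which separate
  holomorphy does not provide directly.\<close>

lemma derivative_of_pointwise_limit:
  fixes X Y :: "nat \<Rightarrow> complex \<Rightarrow> complex"
  assumes U: "open U" "z0 \<in> U"
    and X: "\<And>n z. z \<in> U \<Longrightarrow> (X n has_field_derivative Y n z) (at z)"
    and Y: "\<And>n z. z \<in> U \<Longrightarrow> (Y n has_field_derivative \<epsilon> n * b z * X n z + d z * Y n z) (at z)"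
    and bd: "continuous_on U b" "continuous_on U d"
    and eps: "convergent \<epsilon>"
    and Xl: "\<And>z. z \<in> U \<Longrightarrow> (\<lambda>n. X n z) \<longlonglongrightarrow> X' z"
    and Yl: "\<And>z. z \<in> U \<Longrightarrow> (\<lambda>n. Y n z) \<longlonglongrightarrow> Y' z"
  shows "(X' has_field_derivative Y' z0) (at z0)"
proof -
  obtain r0 where r0: "r0 > 0" "cball z0 r0 \<subseteq> U"
    using U open_contains_cball by blast
  obtain E where E: "\<And>n. norm (\<epsilon> n) \<le> E"
    using eps convergent_imp_Bseq BseqE by blast
  obtain Kb where Kb: "\<And>z. z \<in> cball z0 r0 \<Longrightarrow> norm (b z) \<le> Kb"
    using continuous_on_compact_bound[OF compact_cball continuous_on_subset[OF bd(1) r0(2)]] by blast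
  obtain Kd where Kd: "\<And>z. z \<in> cball z0 r0 \<Longrightarrow> norm (d z) \<le> Kd"
    using continuous_on_compact_bound[OF compact_cball continuous_on_subset[OF bd(2) r0(2)]] by blast
  define K where "K = max (E * Kb) Kd"
  have K0: "K \<ge> 0" using Kd[of z0] r0 norm_ge_zero[of "d z0"] unfolding K_def
    by (smt (verit) centre_in_cball max.cobounded2)
  \<comment> \<open>Small enough for \<open>pair_bound\<close>, for all \<open>n\<close> at once.\<close>
  define r where "r = min r0 (1 / (2 * (1 + K)))"
  have r: "r > 0" "r * (1 + K) \<le> 1 / 2" "cball z0 r \<subseteq> cball z0 r0"
  proof -
    show "r > 0" using r0 K0 by (simp add: r_def)
    have "r * (1 + K) \<le> 1 / (2 * (1 + K)) * (1 + K)"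
      using K0 by (intro mult_right_mono) (auto simp: r_def)
    also have "\<dots> = 1 / 2" using K0 by (simp add: divide_simps)
    finally show "r * (1 + K) \<le> 1 / 2" .
    show "cball z0 r \<subseteq> cball z0 r0" by (auto simp: r_def)
  qed
  have bound: "norm (X n z) + norm (Y n z) \<le> 2 * (norm (X n z0) + norm (Y n z0))" if "z \<in> cball z0 r" for n z
  proof (rule pair_bound[where p = "\<lambda>z. \<epsilon> n * b z" and q = d and K = K and r = r])
    fix z assume z: "z \<in> cball z0 r"
    have "norm (\<epsilon> n * b z) \<le> E * Kb"
      unfolding norm_mult using E[of n] Kb[of z] z r(3)
      by (intro mult_mono) (auto intro: order_trans[OF norm_ge_zero])
    then show "norm (\<epsilon> n * b z) \<le> K" by (simp add: K_def)
    show "norm (d z) \<le> K" using Kd[of z] z r(3) by (auto simp: K_def)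
    show "(X n has_field_derivative Y n z) (at z)" using X z r(3) r0(2) by blast
    show "(Y n has_field_derivative \<epsilon> n * b z * X n z + d z * Y n z) (at z)"
      using Y z r(3) r0(2) by blast
  qed (use r that in auto)
  have "convergent (\<lambda>n. X n z0)" "convergent (\<lambda>n. Y n z0)"
    using Xl Yl U by (auto simp: convergent_def)
  then obtain B1 B2 where B: "\<And>n. norm (X n z0) \<le> B1" "\<And>n. norm (Y n z0) \<le> B2"
    using convergent_imp_Bseq BseqE by metis
  have Xb: "norm (X n z) \<le> 2 * (B1 + B2)" if "z \<in> ball z0 r" for n z
  proof -
    have "norm (X n z) + norm (Y n z) \<le> 2 * (norm (X n z0) + norm (Y n z0))"
      using bound that by auto
    then show ?thesis
      using B(1)[of n] B(2)[of n] norm_ge_zero[of "Y n z"] by argo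
  qed
  have sub: "ball z0 r \<subseteq> U" using r(3) r0(2) ball_subset_cball by blast
  obtain g s where g: "g holomorphic_on ball z0 r" "strict_mono (s :: nat \<Rightarrow> nat)"
    "\<And>x. x \<in> ball z0 r \<Longrightarrow> (\<lambda>n. X (s n) x) \<longlonglongrightarrow> g x"
    "\<And>K. compact K \<Longrightarrow> K \<subseteq> ball z0 r \<Longrightarrow> uniform_limit K (X \<circ> s) g sequentially"
  proof (rule Montel[of "ball z0 r" "range X" X])
    fix h assume "h \<in> range X"
    then show "h holomorphic_on ball z0 r"
      using X sub by (auto simp: holomorphic_on_open)
  next
    fix K assume "compact K" "K \<subseteq> ball z0 r"
    then show "\<exists>B. \<forall>h\<in>range X. \<forall>z\<in>K. norm (h z) \<le> B"
      using Xb by blast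
  qed auto
  have gX: "g z = X' z" if "z \<in> ball z0 r" for z
  proof -
    have "(\<lambda>n. X (s n) z) \<longlonglongrightarrow> X' z"
      using LIMSEQ_subseq_LIMSEQ[OF Xl g(2)] that sub by (auto simp: o_def)
    then show ?thesis using g(3)[OF that] LIMSEQ_unique by blast
  qed
  have "\<exists>g'. \<forall>x\<in>ball z0 r. (g has_field_derivative g' x) (at x) \<and> (\<lambda>n. Y (s n) x) \<longlonglongrightarrow> g' x"
  proof (rule has_complex_derivative_uniform_sequence[where f = "X \<circ> s"])
    fix x assume "x \<in> ball z0 r"
    then obtain d where "d > 0" "cball x d \<subseteq> ball z0 r"
      using open_contains_cball open_ball by blast
    then show "\<exists>d>0. cball x d \<subseteq> ball z0 r \<and> uniform_limit (cball x d) (X \<circ> s) g sequentially"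
      using g(4)[of "cball x d"] by auto
  qed (use X sub in auto)
  then obtain g' where g': "(g has_field_derivative g') (at z0)" "(\<lambda>n. Y (s n) z0) \<longlonglongrightarrow> g'"
    using r(1) by (metis centre_in_ball)
  have "(\<lambda>n. Y (s n) z0) \<longlonglongrightarrow> Y' z0"
    using LIMSEQ_subseq_LIMSEQ[OF Yl g(2)] U by (auto simp: o_def)
  then have "g' = Y' z0" using g'(2) LIMSEQ_unique by blast
  moreover have "(X' has_field_derivative g') (at z0)"
    using g'(1) gX r(1)
    by (auto intro: has_field_derivative_transform_within_open[of g _ _ "ball z0 r"])
  ultimately show ?thesis by simp
qed

lemma meromorphic_growth:
  assumes "G meromorphic_on {z0}"
  obtains r C n where "r > 0" "C \<ge> 0" 
    "\<And>w. w \<in> ball z0 r - {z0} \<Longrightarrow> norm (G w) * norm (w - z0) ^ n \<le> C"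
proof -
  have iso: "isolated_singularity_at G z0" "not_essential G z0"
    using assms by (auto simp: meromorphic_at_iff)
  show ?thesis
  proof (cases "\<exists>\<^sub>F w in at z0. G w \<noteq> 0")
    case False
    then have "eventually (\<lambda>w. G w = 0) (at z0)" by (simp add: frequently_def)
    then obtain r where r: "r > 0" "\<And>w. w \<noteq> z0 \<Longrightarrow> dist w z0 < r \<Longrightarrow> G w = 0"
      unfolding eventually_at by auto
    show ?thesis
      by (rule that[of r 0 0]) (use r in \<open>auto simp: dist_commute\<close>)
  next
    case True
    obtain k P r where P: "0 < r" "P holomorphic_on cball z0 r"
        "\<And>w. w \<in> cball z0 r - {z0} \<Longrightarrow> G w = P w * (w - z0) powi k \<and> P w \<noteq> 0"
      using holomorphic_factor_puncture[OF iso True] by auto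
    obtain C where C0: "C \<ge> 0" and C: "\<And>w. w \<in> cball z0 r \<Longrightarrow> norm (P w) \<le> C"
      using continuous_on_compact_bound[OF compact_cball holomorphic_on_imp_continuous_on[OF P(2)]]
      by blast
    show ?thesis
    proof (rule that[of "min r 1" C "nat \<bar>k\<bar>"])
      fix w assume w: "w \<in> ball z0 (min r 1) - {z0}"
      define x where "x = norm (w - z0)"
      have x: "0 < x" "x \<le> 1" using w by (auto simp: x_def dist_norm norm_minus_commute)
      have "x powi k * x ^ nat \<bar>k\<bar> \<le> 1"
      proof (cases "k \<ge> 0")
        case True
        then have "x powi k = x ^ nat k" by (simp add: power_int_def)
        moreover have "x ^ nat k \<le> 1" "x ^ nat \<bar>k\<bar> \<le> 1" using x by (auto intro: power_le_one)
        ultimately show ?thesis using x by (simp add: mult_le_one del: power_le_one_iff)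
      next
        case False
        then have "x powi k = inverse (x ^ nat \<bar>k\<bar>)" by (simp add: power_int_def power_inverse)
        then show ?thesis using x by simp
      qed
      moreover have "norm (P w) \<le> C" using C w by auto
      ultimately have "norm (P w) * (x powi k * x ^ nat \<bar>k\<bar>) \<le> C * 1"
        using x C0 by (intro mult_mono) auto
      moreover have "norm (G w) = norm (P w) * x powi k"
        using P(3)[of w] w by (auto simp: norm_mult norm_power_int x_def)
      ultimately show "norm (G w) * norm (w - z0) ^ nat \<bar>k\<bar> \<le> C"
        by (simp add: x_def mult.assoc)
    qed (use P C0 in auto)
  qed
qed

text \<open>Integrating radially inwards from a fixed circle, \<open>F\<close> grows at most like a power of the distance,
  since \<open>G\<close> does; a power of \<open>w - z0\<close> times \<open>F\<close> then has a removable singularity. So an essential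
  singularity cannot disappear under differentiation.\<close>

lemma meromorphic_primitive:
  assumes U: "open U" "z0 \<in> U"
    and F: "\<And>z. z \<in> U - {z0} \<Longrightarrow> (F has_field_derivative G z) (at z)"
    and G: "G meromorphic_on {z0}"
  shows "F meromorphic_on {z0}"
proof -
  obtain r1 C n where r1: "r1 > 0" "C \<ge> 0" 
      and growth: "\<And>w. w \<in> ball z0 r1 - {z0} \<Longrightarrow> norm (G w) * norm (w - z0) ^ n \<le> C"
    using meromorphic_growth[OF G] by blast
  obtain r2 where r2: "r2 > 0" "ball z0 r2 \<subseteq> U"
    using U open_contains_ball by blast
  define r where "r = Min {r1, r2, 1} / 2"
  have r: "r > 0" "r < r1" "r < r2" "r < 1" using r1 r2 by (auto simp: r_def min_def)
  have cont: "continuous_on (U - {z0}) F"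
    using F DERIV_isCont by (blast intro: continuous_at_imp_continuous_on)
  have "sphere z0 r \<subseteq> U - {z0}" using r r2 by (auto simp: subset_iff dist_commute)
  then obtain M where M0: "M \<ge> 0" and M: "\<And>w. w \<in> sphere z0 r \<Longrightarrow> norm (F w) \<le> M"
    using continuous_on_compact_bound[OF compact_sphere continuous_on_subset[OF cont]] by blast
  define H where "H = (\<lambda>w. (w - z0) ^ n * F w)"
  have bnd: "norm (H w) \<le> C + M" if w: "w \<in> ball z0 r - {z0}" for w
  proof -
    define x where "x = norm (w - z0)"
    have x: "0 < x" "x < r" using w by (auto simp: x_def dist_norm norm_minus_commute)
    \<comment> \<open>The point of the circle of radius \<open>r\<close> on the ray through \<open>w\<close>; along the segment from \<open>w\<close>
      to \<open>e\<close> the distance to \<open>z0\<close> stays at least \<open>x\<close>, so \<open>C / x ^ n\<close> bounds \<open>G\<close> there.\<close>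
    define e where "e = z0 + of_real (r / x) * (w - z0)"
    have e: "e \<in> sphere z0 r" using x r by (simp add: e_def dist_norm norm_mult norm_divide x_def)
    have seg: "y \<in> ball z0 r1 - {z0} \<and> y \<in> U - {z0} \<and> x \<le> norm (y - z0)" 
      if y: "y \<in> closed_segment w e" for y
    proof -
      obtain t where t: "0 \<le> t" "t \<le> 1" "y = (1 - t) *\<^sub>R w + t *\<^sub>R e"
        using y by (auto simp: in_segment)
      have "y - z0 = of_real ((1 - t) + t * (r / x)) * (w - z0)"
        unfolding t(3) e_def by (simp add: scaleR_conv_of_real algebra_simps)
      then have ny: "norm (y - z0) = \<bar>(1 - t) + t * (r / x)\<bar> * x"
        by (simp only: norm_mult norm_of_real x_def)
      have "r / x \<ge> 1" using x by simp
      then have "t * 1 \<le> t * (r / x)" using t by (intro mult_left_mono) auto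
      then have s: "1 \<le> (1 - t) + t * (r / x)" by simp
      then have *: "norm (y - z0) = ((1 - t) + t * (r / x)) * x" using ny by simp
      have "1 * x \<le> norm (y - z0)" unfolding * using s x by (intro mult_right_mono) auto
      moreover have "norm (y - z0) = (1 - t) * x + t * r" unfolding * using x by (simp add: field_simps)
      then have "norm (y - z0) \<le> (1 - t) * r + t * r"
        using x t by (simp add: mult_left_mono)
      then have "norm (y - z0) \<le> r" by (simp add: algebra_simps)
      ultimately show ?thesis
        using x r r2 by (auto simp: dist_norm norm_minus_commute subset_iff)
    qed
    have "norm (F w - F e) \<le> (C / x ^ n) * norm (w - e)"
    proof (rule field_differentiable_bound[of "closed_segment w e"])
      fix y assume y: "y \<in> closed_segment w e"
      show "(F has_field_derivative G y) (at y within closed_segment w e)"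
        using F seg[OF y] by (auto intro: has_field_derivative_at_within)
      have "norm (G y) * x ^ n \<le> norm (G y) * norm (y - z0) ^ n"
        using seg[OF y] x by (intro mult_left_mono power_mono) auto
      also have "\<dots> \<le> C" using growth seg[OF y] by blast
      finally show "norm (G y) \<le> C / x ^ n" using x by (simp add: field_simps)
    qed auto
    also have "\<dots> \<le> (C / x ^ n) * 1"
    proof (rule mult_left_mono)
      have "w - e = of_real (1 - r / x) * (w - z0)" by (simp add: e_def algebra_simps)
      then have "norm (w - e) = \<bar>1 - r / x\<bar> * x" by (simp only: norm_mult norm_of_real x_def)
      also have "\<dots> = r - x" using x by (simp add: field_simps abs_if)
      finally show "norm (w - e) \<le> 1" using x r by simp
    qed (use r1 x in auto)
    finally have "norm (F w) \<le> C / x ^ n + M"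
      using M[OF e] norm_triangle_sub[of "F w" "F e"] by simp
    then have "x ^ n * norm (F w) \<le> x ^ n * (C / x ^ n + M)"
      using x by (intro mult_left_mono) auto
    also have "\<dots> = C + x ^ n * M" using x by (simp add: field_simps)
    also have "\<dots> \<le> C + 1 * M"
      using x r M0 by (intro add_left_mono mult_right_mono power_le_one) auto
    finally show ?thesis by (simp add: H_def norm_mult norm_power x_def)
  qed
  have Fh: "F holomorphic_on ball z0 r - {z0}"
  proof (rule holomorphic_on_subset)
    show "F holomorphic_on U - {z0}"
      using F U(1) by (auto simp: holomorphic_on_open open_delete)
    show "ball z0 r - {z0} \<subseteq> U - {z0}" using r r2(2) by auto
  qed
  then have "H holomorphic_on ball z0 r - {z0}"
    unfolding H_def by (intro holomorphic_intros)
  moreover have "\<exists>B. eventually (\<lambda>w. norm (H w) \<le> B) (at z0)"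
    using bnd r(1) unfolding eventually_at
    by (intro exI[of _ "C + M"] exI[of _ r]) (auto simp: dist_commute)
  ultimately obtain h where h: "h holomorphic_on ball z0 r" "\<And>w. w \<in> ball z0 r - {z0} \<Longrightarrow> h w = H w"
    using holomorphic_on_extend_bounded[of H "ball z0 r" z0] r(1) by auto
  have "h analytic_on {z0}"
    unfolding analytic_at using h(1) r(1) by (intro exI[of _ "ball z0 r"]) simp
  then have "(\<lambda>w. h w / (w - z0) ^ n) meromorphic_on {z0}"
    by (intro meromorphic_on_divide meromorphic_on_power meromorphic_on_diff meromorphic_on_id
          meromorphic_on_const analytic_on_imp_meromorphic_on)
  moreover have "eventually (\<lambda>w. h w / (w - z0) ^ n = F w) (at z0)"
    using h(2) r(1) unfolding eventually_at
    by (intro exI[of _ r]) (auto simp: dist_commute H_def)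
  ultimately show ?thesis
    using meromorphic_on_cong[of "{z0}" "\<lambda>w. h w / (w - z0) ^ n" F "{z0}"] by auto
qed

section \<open>Functions in a chart\<close>

definition chart_map :: "'a::topological_space chart \<Rightarrow> bool" where
  "chart_map c \<longleftrightarrow> open (fst c) \<and> open (snd c ` fst c) \<and>
     homeomorphism (fst c) (snd c ` fst c) (snd c) (inv_into (fst c) (snd c))"

lemma riemann_surface_chart_map: "riemann_surface At \<Longrightarrow> c \<in> At \<Longrightarrow> chart_map c"
  by (auto simp: riemann_surface_def chart_map_def)

lemma chart_inj: "chart_map c \<Longrightarrow> inj_on (snd c) (fst c)"
  unfolding chart_map_def homeomorphism_def by (metis inj_onI)

lemma chart_inv: "chart_map c \<Longrightarrow> x \<in> fst c \<Longrightarrow> inv_into (fst c) (snd c) (snd c x) = x"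
  by (simp add: chart_inj)

lemma in_coord_apply: "chart_map c \<Longrightarrow> x \<in> fst c \<Longrightarrow> in_coord c f (snd c x) = f x"
  by (simp add: in_coord_def chart_inv)

lemma chart_image_open:
  assumes "chart_map c" "open V"
  shows "open (snd c ` (fst c \<inter> V))"
proof -
  have "openin (top_of_set (snd c ` fst c)) (snd c ` (fst c \<inter> V))"
    using assms homeomorphism_imp_open_map[of "fst c" "snd c ` fst c" "snd c"]
    unfolding chart_map_def by (auto simp: openin_open_Int)
  then show ?thesis
    using assms(1) openin_open_trans unfolding chart_map_def by blast
qed

lemma eventually_at_chart:
  assumes c: "chart_map c" "x \<in> fst c" and ev: "eventually R (at (snd c x))"
  shows "eventually (\<lambda>y. y \<in> fst c \<and> R (snd c y)) (at x)"
proof -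
  obtain S where S: "open S" "snd c x \<in> S" "\<And>t. t \<in> S \<Longrightarrow> t \<noteq> snd c x \<Longrightarrow> R t"
    using ev unfolding eventually_at_topological by blast
  have "continuous_on (fst c) (snd c)" "open (fst c)"
    using c(1) by (auto simp: chart_map_def homeomorphism_def)
  then have "open (snd c -` S \<inter> fst c)"
    using S(1) continuous_on_open_vimage by blast
  moreover have "x \<in> snd c -` S \<inter> fst c" using c S by auto
  moreover have "y \<in> fst c \<and> R (snd c y)" if "y \<in> snd c -` S \<inter> fst c" "y \<noteq> x" for y
    using that S(3) c inj_onD[OF chart_inj[OF c(1)]] by auto
  ultimately show ?thesis unfolding eventually_at_topological by blast
qed

lemma eventually_at_chart_image:
  assumes c: "chart_map c" "x \<in> fst c" and ev: "eventually R (at x)"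
  shows "eventually (\<lambda>t. t \<in> snd c ` fst c \<and> R (inv_into (fst c) (snd c) t)) (at (snd c x))"
proof -
  obtain S where S: "open S" "x \<in> S" "\<And>y. y \<in> S \<Longrightarrow> y \<noteq> x \<Longrightarrow> R y"
    using ev unfolding eventually_at_topological by blast
  have "open (snd c ` (fst c \<inter> S))" using c S by (intro chart_image_open)
  moreover have "snd c x \<in> snd c ` (fst c \<inter> S)" using c S by auto
  moreover have "t \<in> snd c ` fst c \<and> R (inv_into (fst c) (snd c) t)"
    if t: "t \<in> snd c ` (fst c \<inter> S)" "t \<noteq> snd c x" for t
  proof -
    obtain y where "y \<in> fst c" "y \<in> S" "t = snd c y" using t(1) by auto
    then show ?thesis using t(2) S(3)[of y] c by (auto simp: chart_inv)
  qed
  ultimately show ?thesis unfolding eventually_at_topological by blast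
qed

lemma at_chart_neq_bot:
  assumes "chart_map c" "x \<in> fst c"
  shows "at x \<noteq> bot"
proof
  assume "at x = bot"
  then have "eventually (\<lambda>_. False) (at x)" by simp
  from eventually_at_chart_image[OF assms this] show False by simp
qed

lemma open_eventually_at: "open {x::'a::t1_space. eventually R (at x)}"
proof (subst open_subopen, intro ballI)
  fix x assume "x \<in> {x. eventually R (at x)}"
  then obtain S where S: "open S" "x \<in> S" "\<And>y. y \<in> S \<Longrightarrow> y \<noteq> x \<Longrightarrow> R y"
    by (auto simp: eventually_at_topological)
  have "eventually R (at z)" if "z \<in> S" for z
  proof (cases "z = x")
    case False
    then have "open (S - {x})" "z \<in> S - {x}" using S that by auto
    then show ?thesis unfolding eventually_at_topological using S(3) by blast
  qed (use S in \<open>auto simp: eventually_at_topological\<close>)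
  then show "\<exists>T. open T \<and> x \<in> T \<and> T \<subseteq> {x. eventually R (at x)}"
    using S by blast
qed

lemma holo_in_chart_intros:
  shows "holo_in_chart c V (\<lambda>x. k)"
    and "holo_in_chart c V f \<Longrightarrow> holo_in_chart c V (\<lambda>x. - f x)"
    and "holo_in_chart c V f \<Longrightarrow> holo_in_chart c V g \<Longrightarrow> holo_in_chart c V (\<lambda>x. f x + g x)"
    and "holo_in_chart c V f \<Longrightarrow> holo_in_chart c V g \<Longrightarrow> holo_in_chart c V (\<lambda>x. f x - g x)"
    and "holo_in_chart c V f \<Longrightarrow> holo_in_chart c V g \<Longrightarrow> holo_in_chart c V (\<lambda>x. f x * g x)"
  unfolding holo_in_chart_def in_coord_def by (auto intro!: holomorphic_intros)

lemma holo_in_chart_subset: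
  "holo_in_chart c V f \<Longrightarrow> fst c \<inter> W \<subseteq> V \<Longrightarrow> holo_in_chart c W f"
  unfolding holo_in_chart_def by (erule holomorphic_on_subset) auto

lemma has_dz:
  assumes "chart_map c" "open V" "holo_in_chart c V f" "x \<in> fst c" "x \<in> V"
  shows "(in_coord c f has_field_derivative dz c f x) (at (snd c x))"
  unfolding dz_def
  by (rule holomorphic_derivI[OF assms(3)[unfolded holo_in_chart_def]])
     (use assms chart_image_open in blast)+

lemma holo_in_chartI:
  assumes "chart_map c" "open V"
    and "\<And>x. x \<in> fst c \<Longrightarrow> x \<in> V \<Longrightarrow> \<exists>D. (in_coord c f has_field_derivative D) (at (snd c x))"
  shows "holo_in_chart c V f"
  unfolding holo_in_chart_def
  using assms by (auto simp: holomorphic_on_open chart_image_open)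

lemma in_coord_cong:
  assumes "chart_map c" "\<And>y. y \<in> fst c \<Longrightarrow> y \<in> V \<Longrightarrow> f y = g y" "t \<in> snd c ` (fst c \<inter> V)"
  shows "in_coord c f t = in_coord c g t"
  using assms by (auto simp: in_coord_apply)

lemma holo_in_chart_cong:
  assumes "chart_map c" "\<And>y. y \<in> fst c \<Longrightarrow> y \<in> V \<Longrightarrow> f y = g y"
  shows "holo_in_chart c V f \<longleftrightarrow> holo_in_chart c V g"
  unfolding holo_in_chart_def
  by (rule holomorphic_cong[OF refl in_coord_cong[OF assms]])

lemma dz_cong:
  assumes "chart_map c" "open V" "x \<in> fst c" "x \<in> V" "\<And>y. y \<in> fst c \<Longrightarrow> y \<in> V \<Longrightarrow> f y = g y"
  shows "dz c f x = dz c g x"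
  unfolding dz_def
proof (rule deriv_cong_ev)
  have "eventually (\<lambda>t. t \<in> snd c ` (fst c \<inter> V)) (nhds (snd c x))"
    using assms by (intro eventually_nhds_in_open chart_image_open) auto
  then show "eventually (\<lambda>t. in_coord c f t = in_coord c g t) (nhds (snd c x))"
    by eventually_elim (rule in_coord_cong[OF assms(1) assms(5)])
qed simp

lemma dz_rules:
  assumes "chart_map c" "open V" "x \<in> fst c" "x \<in> V"
    and f: "holo_in_chart c V f" and g: "holo_in_chart c V g"
  shows "dz c (\<lambda>y. f y + g y) x = dz c f x + dz c g x"
    and "dz c (\<lambda>y. f y - g y) x = dz c f x - dz c g x"
    and "dz c (\<lambda>y. f y * g y) x = dz c f x * g x + f x * dz c g x"
proof -
  note F = has_dz[OF assms(1,2) f assms(3,4)] and G = has_dz[OF assms(1,2) g assms(3,4)]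
  show "dz c (\<lambda>y. f y + g y) x = dz c f x + dz c g x"
    using DERIV_imp_deriv[OF DERIV_add[OF F G]] by (simp add: dz_def in_coord_def)
  show "dz c (\<lambda>y. f y - g y) x = dz c f x - dz c g x"
    using DERIV_imp_deriv[OF DERIV_diff[OF F G]] by (simp add: dz_def in_coord_def)
  have "in_coord c f (snd c x) = f x" "in_coord c g (snd c x) = g x"
    using assms by (simp_all add: in_coord_apply)
  then show "dz c (\<lambda>y. f y * g y) x = dz c f x * g x + f x * dz c g x"
    using DERIV_imp_deriv[OF DERIV_mult[OF F G]]
    by (simp add: dz_def[of c "\<lambda>y. f y * g y"] in_coord_def mult.commute)
qed

lemma dz_const: "dz c (\<lambda>y. k) x = 0"
  by (simp add: dz_def in_coord_def)

lemma holo_in_chart_dz: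
  assumes "chart_map c" "open V" "holo_in_chart c V f"
  shows "holo_in_chart c V (dz c f)"
proof -
  have "deriv (in_coord c f) holomorphic_on snd c ` (fst c \<inter> V)"
    using assms by (intro holomorphic_deriv chart_image_open) (auto simp: holo_in_chart_def)
  moreover have "in_coord c (dz c f) t = deriv (in_coord c f) t" if "t \<in> snd c ` (fst c \<inter> V)" for t
    using that assms(1) by (auto simp: in_coord_apply) (auto simp: dz_def)
  ultimately show ?thesis
    unfolding holo_in_chart_def using holomorphic_cong by (metis (no_types, lifting))
qed

lemma dz_chain:
  assumes R: "riemann_surface At" "c \<in> At" "d \<in> At"
    and V: "open V" "holo_in_chart d V f" "x \<in> fst c" "x \<in> fst d" "x \<in> V"
  shows "dz c f x = dz c (snd d) x * dz d f x"
proof -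
  have cm: "chart_map c" "chart_map d" using R riemann_surface_chart_map by blast+
  have od: "open (fst d)" using cm(2) by (simp add: chart_map_def)
  have "in_coord c (snd d) holomorphic_on snd c ` (fst c \<inter> fst d)"
    using R by (auto simp: riemann_surface_def)
  then have h: "holo_in_chart c (fst d) (snd d)" by (simp add: holo_in_chart_def)
  have D: "(in_coord c (snd d) has_field_derivative dz c (snd d) x) (at (snd c x))"
    using has_dz[OF cm(1) od h] V by auto
  have e: "in_coord c (snd d) (snd c x) = snd d x" using cm V by (simp add: in_coord_apply)
  have F: "(in_coord d f has_field_derivative dz d f x) (at (in_coord c (snd d) (snd c x)))"
    unfolding e using has_dz[OF cm(2) V(1,2)] V by auto
  have "deriv (in_coord c f) (snd c x) = deriv (in_coord d f \<circ> in_coord c (snd d)) (snd c x)"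
  proof (rule deriv_cong_ev)
    have "eventually (\<lambda>t. t \<in> snd c ` (fst c \<inter> fst d)) (nhds (snd c x))"
      using V cm od by (intro eventually_nhds_in_open chart_image_open) auto
    then show "eventually (\<lambda>t. in_coord c f t = (in_coord d f \<circ> in_coord c (snd d)) t) (nhds (snd c x))"
      by eventually_elim (use cm in \<open>auto simp: in_coord_apply\<close>)
  qed simp
  also have "\<dots> = dz d f x * dz c (snd d) x"
    by (rule DERIV_imp_deriv[OF DERIV_chain[OF F D]])
  finally show ?thesis by (simp add: dz_def[of c f] mult.commute)
qed

text \<open>The regularity required of potentials and frames alike, as one notion that is closed under
  arithmetic and differentiation.\<close>

definition mero_off :: "'a::topological_space chart \<Rightarrow> 'a set \<Rightarrow> ('a \<Rightarrow> complex) \<Rightarrow> bool" where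
  "mero_off c Q f \<longleftrightarrow> holo_in_chart c (- Q) f \<and> mero_in_chart c f"

lemma mero_off_intros:
  shows "mero_off c Q (\<lambda>x. k)"
    and "mero_off c Q f \<Longrightarrow> mero_off c Q (\<lambda>x. - f x)"
    and "mero_off c Q f \<Longrightarrow> mero_off c Q g \<Longrightarrow> mero_off c Q (\<lambda>x. f x + g x)"
    and "mero_off c Q f \<Longrightarrow> mero_off c Q g \<Longrightarrow> mero_off c Q (\<lambda>x. f x - g x)"
    and "mero_off c Q f \<Longrightarrow> mero_off c Q g \<Longrightarrow> mero_off c Q (\<lambda>x. f x * g x)"
  unfolding mero_off_def mero_in_chart_def
  by (auto intro!: holo_in_chart_intros) (auto simp: in_coord_def intro!: meromorphic_intros)

lemma mero_off_divide:
  assumes "chart_map c" "mero_off c Q f" "mero_off c Q g" "\<And>x. x \<in> fst c \<Longrightarrow> x \<notin> Q \<Longrightarrow> g x \<noteq> 0"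
  shows "mero_off c Q (\<lambda>x. f x / g x)"
proof -
  have nz: "in_coord c g t \<noteq> 0" if "t \<in> snd c ` (fst c \<inter> - Q)" for t
    using that assms by (auto simp: in_coord_apply)
  have "(\<lambda>t. in_coord c f t / in_coord c g t) holomorphic_on snd c ` (fst c \<inter> - Q)"
    using assms nz by (intro holomorphic_intros) (auto simp: mero_off_def holo_in_chart_def)
  moreover have "(\<lambda>t. in_coord c f t / in_coord c g t) meromorphic_on snd c ` fst c"
    using assms by (intro meromorphic_intros) (auto simp: mero_off_def mero_in_chart_def)
  ultimately show ?thesis
    unfolding mero_off_def holo_in_chart_def mero_in_chart_def by (simp add: in_coord_def)
qed

lemma mero_off_mono: "mero_off c P f \<Longrightarrow> P \<subseteq> Q \<Longrightarrow> mero_off c Q f"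
  unfolding mero_off_def by (auto elim: holo_in_chart_subset)

lemma sparse_eventually: "Q sparse_in UNIV \<Longrightarrow> eventually (\<lambda>y. y \<notin> Q) (at x)"
  by (simp add: sparse_in_eventually_iff)

lemma sparse_open: "Q sparse_in UNIV \<Longrightarrow> open (- Q)"
  using sparse_in_UNIV_imp_closed by auto

lemma mero_off_cong:
  assumes c: "chart_map c" and Q: "Q sparse_in UNIV"
    and f: "mero_off c Q f" and eq: "\<And>x. x \<in> fst c \<Longrightarrow> x \<notin> Q \<Longrightarrow> f x = g x"
  shows "mero_off c Q g"
proof -
  have "eventually (\<lambda>t. in_coord c f t = in_coord c g t) (at z)" if z: "z \<in> snd c ` fst c" for z
  proof -
    obtain x where x: "x \<in> fst c" "z = snd c x" using z by auto
    from eventually_at_chart_image[OF c x(1) sparse_eventually[OF Q]]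
    show ?thesis unfolding x(2)
    proof eventually_elim
      case (elim t)
      then show ?case using eq c by (auto simp: in_coord_apply chart_inv)
    qed
  qed
  then have "mero_in_chart c g"
    using f meromorphic_on_cong[of "snd c ` fst c" "in_coord c f" "in_coord c g" "snd c ` fst c"]
    unfolding mero_off_def mero_in_chart_def by auto
  moreover have "holo_in_chart c (- Q) g"
    using f holo_in_chart_cong[OF c, of "- Q" f g] eq by (auto simp: mero_off_def)
  ultimately show ?thesis by (simp add: mero_off_def)
qed

lemma mero_off_dz:
  assumes c: "chart_map c" and Q: "Q sparse_in UNIV" and f: "mero_off c Q f"
  shows "mero_off c Q (dz c f)"
proof -
  have "deriv (in_coord c f) meromorphic_on snd c ` fst c"
    using f by (intro meromorphic_intros) (auto simp: mero_off_def mero_in_chart_def)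
  moreover have "eventually (\<lambda>t. in_coord c (dz c f) t = deriv (in_coord c f) t) (at z)"
    if z: "z \<in> snd c ` fst c" for z
  proof -
    have "eventually (\<lambda>t. t \<in> snd c ` fst c) (at z)"
      using c z by (intro eventually_at_in_open') (auto simp: chart_map_def)
    then show ?thesis
    proof eventually_elim
      case (elim t)
      then obtain x where "x \<in> fst c" "t = snd c x" by auto
      then show ?case using c by (simp add: in_coord_apply dz_def)
    qed
  qed
  ultimately have "in_coord c (dz c f) meromorphic_on snd c ` fst c"
    using meromorphic_on_cong[of "snd c ` fst c" "in_coord c (dz c f)" "deriv (in_coord c f)" "snd c ` fst c"]
    by blast
  moreover have "holo_in_chart c (- Q) (dz c f)"
    using holo_in_chart_dz[OF c sparse_open[OF Q]] f by (auto simp: mero_off_def)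
  ultimately show ?thesis by (simp add: mero_off_def mero_in_chart_def)
qed

text \<open>The global form of \<open>meromorphic_primitive\<close>, used at the one spectral value where the dressed
  frame is a derivative in the parameter and meromorphy at the poles is not evident.\<close>

lemma mero_off_primitive:
  assumes c: "chart_map c" and Q: "Q sparse_in UNIV" and f: "holo_in_chart c (- Q) f"
    and g: "mero_off c Q g" and eq: "\<And>x. x \<in> fst c \<Longrightarrow> x \<notin> Q \<Longrightarrow> dz c f x = g x"
  shows "mero_off c Q f"
proof -
  have "in_coord c f meromorphic_on {z}" if z: "z \<in> snd c ` fst c" for z
  proof -
    obtain x where x: "x \<in> fst c" "z = snd c x" using z by auto
    obtain B where B: "open B" "x \<in> B" "\<And>y. y \<in> B \<Longrightarrow> y \<noteq> x \<Longrightarrow> y \<notin> Q"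
      using sparse_in_not_in[OF Q UNIV_I] by metis
    show ?thesis
    proof (rule meromorphic_primitive)
      show "open (snd c ` (fst c \<inter> B))" using c B by (intro chart_image_open)
      show "z \<in> snd c ` (fst c \<inter> B)" using x B by auto
      show "in_coord c g meromorphic_on {z}"
        using g z by (auto simp: mero_off_def mero_in_chart_def elim: meromorphic_on_subset)
      fix t assume "t \<in> snd c ` (fst c \<inter> B) - {z}"
      then obtain y where y: "y \<in> fst c" "y \<in> B" "t = snd c y" "y \<noteq> x" using x by auto
      then have "(in_coord c f has_field_derivative dz c f y) (at t)"
        using has_dz[OF c sparse_open[OF Q] f] B by auto
      then show "(in_coord c f has_field_derivative in_coord c g t) (at t)"
        using y eq B c by (simp add: in_coord_apply)
    qed
  qed
  then have "in_coord c f meromorphic_on snd c ` fst c"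
    using meromorphic_on_meromorphic_at by blast
  then show ?thesis using f by (simp add: mero_off_def mero_in_chart_def)
qed

definition holo_vec :: "'a::topological_space chart \<Rightarrow> 'a set \<Rightarrow> ('a \<Rightarrow> complex^2) \<Rightarrow> bool" where
  "holo_vec c V u \<longleftrightarrow> (\<forall>i. holo_in_chart c V (\<lambda>x. u x $ i))"

definition holo_mat :: "'a::topological_space chart \<Rightarrow> 'a set \<Rightarrow> ('a \<Rightarrow> complex^2^2) \<Rightarrow> bool" where
  "holo_mat c V F \<longleftrightarrow> (\<forall>i j. holo_in_chart c V (\<lambda>x. F x $ i $ j))"

definition mero_vec :: "'a::topological_space chart \<Rightarrow> 'a set \<Rightarrow> ('a \<Rightarrow> complex^2) \<Rightarrow> bool" where
  "mero_vec c Q u \<longleftrightarrow> (\<forall>i. mero_off c Q (\<lambda>x. u x $ i))"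

definition mero_mat :: "'a::topological_space chart \<Rightarrow> 'a set \<Rightarrow> ('a \<Rightarrow> complex^2^2) \<Rightarrow> bool" where
  "mero_mat c Q F \<longleftrightarrow> (\<forall>i j. mero_off c Q (\<lambda>x. F x $ i $ j))"

lemma mero_imp_holo: "mero_vec c Q u \<Longrightarrow> holo_vec c (- Q) u" "mero_mat c Q F \<Longrightarrow> holo_mat c (- Q) F"
  by (auto simp: mero_vec_def mero_mat_def holo_vec_def holo_mat_def mero_off_def)

lemma holo_vec_subset: "holo_vec c V u \<Longrightarrow> W \<subseteq> V \<Longrightarrow> holo_vec c W u"
  and holo_mat_subset: "holo_mat c V F \<Longrightarrow> W \<subseteq> V \<Longrightarrow> holo_mat c W F"
  unfolding holo_vec_def holo_mat_def by (blast intro: holo_in_chart_subset)+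

lemma mero_vec_mult: "mero_mat c Q F \<Longrightarrow> mero_vec c Q u \<Longrightarrow> mero_vec c Q (\<lambda>x. F x *v u x)"
  by (auto simp: mero_vec_def mero_mat_def mult_vec2 intro!: mero_off_intros)

lemma mero_mat_mult: "mero_mat c Q F \<Longrightarrow> mero_mat c Q G \<Longrightarrow> mero_mat c Q (\<lambda>x. F x ** G x)"
  by (auto simp: mero_mat_def mult_mat2 intro!: mero_off_intros)

lemma mero_mat_const: "mero_mat c Q (\<lambda>x. M)"
  by (auto simp: mero_mat_def intro!: mero_off_intros)

lemma holo_vec_mult: "holo_mat c V F \<Longrightarrow> holo_vec c V u \<Longrightarrow> holo_vec c V (\<lambda>x. F x *v u x)"
  by (auto simp: holo_vec_def holo_mat_def mult_vec2 intro!: holo_in_chart_intros)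

lemma mero_cross2: "mero_vec c Q u \<Longrightarrow> mero_vec c Q w \<Longrightarrow> mero_off c Q (\<lambda>x. cross2 (u x) (w x))"
  by (auto simp: mero_vec_def cross2_def intro!: mero_off_intros)

lemma mero_vec_dz: "chart_map c \<Longrightarrow> Q sparse_in UNIV \<Longrightarrow> mero_vec c Q u \<Longrightarrow> mero_vec c Q (dz_vec c u)"
  by (simp add: mero_vec_def dz_vec_def mero_off_dz)

lemma mero_vec_add: "mero_vec c Q u \<Longrightarrow> mero_vec c Q w \<Longrightarrow> mero_vec c Q (\<lambda>x. u x + w x)"
  by (auto simp: mero_vec_def intro!: mero_off_intros)

lemma dz_vec_mult:
  assumes "chart_map c" "open V" "x \<in> fst c" "x \<in> V" "holo_mat c V F" "holo_vec c V u"
  shows "dz_vec c (\<lambda>y. F y *v u y) x = dz_mat c F x *v u x + F x *v dz_vec c u x"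
proof -
  have H: "holo_in_chart c V (\<lambda>x. F x $ i $ j)" "holo_in_chart c V (\<lambda>x. u x $ j)" for i j
    using assms by (auto simp: holo_mat_def holo_vec_def)
  show ?thesis
    by (simp add: vec_eq_iff dz_vec_def dz_mat_def mult_vec2 
        dz_rules[OF assms(1-4)] H holo_in_chart_intros)
qed

lemma dz_vec_cong:
  assumes "chart_map c" "open V" "x \<in> fst c" "x \<in> V" "\<And>y. y \<in> fst c \<Longrightarrow> y \<in> V \<Longrightarrow> u y = w y"
  shows "dz_vec c u x = dz_vec c w x"
proof -
  have "dz c (\<lambda>y. u y $ i) x = dz c (\<lambda>y. w y $ i) x" for i
    by (rule dz_cong[OF assms(1-4)]) (simp add: assms(5))
  then show ?thesis by (simp add: dz_vec_def)
qed

lemma dz_vec_const: "dz_vec c (\<lambda>y. k) x = 0"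
  by (simp add: dz_vec_def vec_eq_iff dz_const)

lemma dz_vec_smult:
  assumes "chart_map c" "open V" "x \<in> fst c" "x \<in> V" "holo_vec c V u"
  shows "dz_vec c (\<lambda>y. k *s u y) x = k *s dz_vec c u x"
  using assms dz_rules(3)[OF assms(1-4), of "\<lambda>x. k"]
  by (simp add: vec_eq_iff dz_vec_def holo_vec_def holo_in_chart_intros dz_const)

lemma dz_cross2:
  assumes "chart_map c" "open V" "x \<in> fst c" "x \<in> V" "holo_vec c V u" "holo_vec c V w"
  shows "dz c (\<lambda>y. cross2 (u y) (w y)) x = cross2 (dz_vec c u x) (w x) + cross2 (u x) (dz_vec c w x)"
proof -
  have H: "holo_in_chart c V (\<lambda>x. u x $ j)" "holo_in_chart c V (\<lambda>x. w x $ j)" for j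
    using assms by (auto simp: holo_vec_def)
  show ?thesis
    by (simp add: cross2_def dz_vec_def dz_rules[OF assms(1-4)] H holo_in_chart_intros)
qed

lemma dz_mat_const_mult:
  assumes "chart_map c" "open V" "x \<in> fst c" "x \<in> V" "holo_mat c V F"
  shows "dz_mat c (\<lambda>y. M ** F y) x = M ** dz_mat c F x"
proof -
  have H: "holo_in_chart c V (\<lambda>x. F x $ i $ j)" for i j
    using assms by (auto simp: holo_mat_def)
  show ?thesis
    by (simp add: vec_eq_iff dz_mat_def mult_mat2 
        dz_rules[OF assms(1-4)] H holo_in_chart_intros dz_const)
qed

lemma mero_basis_map:
  assumes "chart_map c" "mero_vec c Q a" "mero_vec c Q b" "mero_vec c Q a'" "mero_vec c Q b'"
    "\<And>x. x \<in> fst c \<Longrightarrow> x \<notin> Q \<Longrightarrow> cross2 (a x) (b x) \<noteq> 0"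
  shows "mero_mat c Q (\<lambda>x. basis_map (a x) (b x) (a' x) (b' x))"
proof -
  have ax: "mero_vec c Q (\<lambda>x. axis j 1)" for j
    by (simp add: mero_vec_def mero_off_intros)
  show ?thesis
    unfolding mero_mat_def basis_map_def vec_lambda_beta
    using assms(4,5)
    by (intro allI mero_off_divide mero_off_intros mero_cross2 ax assms(1,2,3,6))
       (auto simp: mero_vec_def)
qed

lemma mero_mat_cong:
  assumes "chart_map c" "Q sparse_in UNIV" "mero_mat c Q F" "\<And>x. x \<in> fst c \<Longrightarrow> x \<notin> Q \<Longrightarrow> F x = F' x"
  shows "mero_mat c Q F'"
  unfolding mero_mat_def
proof (intro allI)
  fix i j show "mero_off c Q (\<lambda>x. F' x $ i $ j)"
    by (rule mero_off_cong[OF assms(1,2), of "\<lambda>x. F x $ i $ j"]) 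
       (use assms(3,4) in \<open>auto simp: mero_mat_def\<close>)
qed

lemma dz_frame:
  assumes "lwr_frame At P \<Phi>" "x \<notin> P"
  shows "dz_mat c (\<lambda>y. \<Phi> y l) x = \<Phi> x l ** maurer_cartan \<Phi> c x l"
proof -
  have "det (\<Phi> x l) = 1" using assms by (simp add: lwr_frame_def)
  then have "\<Phi> x l ** (matrix_inv (\<Phi> x l) ** M) = M" for M :: "complex^2^2"
    using invertible_matrix_inv(2) det_1_invertible by (metis matrix_mul_assoc matrix_mul_lid)
  then show ?thesis by (simp add: maurer_cartan_def)
qed

lemma mero_frame: "lwr_frame At P \<Phi> \<Longrightarrow> c \<in> At \<Longrightarrow> mero_mat c P (\<lambda>x. \<Phi> x l)"
  unfolding lwr_frame_def mero_mat_def mero_off_def by blast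

section \<open>The kernel line and its images\<close>

text \<open>The data of one dressing: the frame, its potential expanded at the spectral value \<open>\<alpha>\<close> of the
  factor as \<open>(l - \<alpha>) A + C\<close> in each chart, and the factor \<open>g\<close> given by its eigenvectors.\<close>

locale lwr_dressing =
  fixes At :: "'a::t2_space chart set"
    and P :: "'a set"
    and \<Phi> :: "'a \<Rightarrow> complex \<Rightarrow> complex^2^2"
    and A C :: "'a chart \<Rightarrow> 'a \<Rightarrow> complex^2^2"
    and \<alpha> :: complex
    and v0 m0 :: "complex^2"
    and g :: "complex \<Rightarrow> complex^2^2"
  assumes surface: "riemann_surface At"
    and frame: "lwr_frame At P \<Phi>"
    and mero_A: "c \<in> At \<Longrightarrow> mero_mat c P (A c)"
    and mero_C: "c \<in> At \<Longrightarrow> mero_mat c P (C c)"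
    and potential: "c \<in> At \<Longrightarrow> x \<in> fst c \<Longrightarrow> x \<notin> P \<Longrightarrow>
          maurer_cartan \<Phi> c x l = scale_mat (l - \<alpha>) (A c x) + C c x"
    and nilpotent: "c \<in> At \<Longrightarrow> x \<in> fst c \<Longrightarrow> x \<notin> P \<Longrightarrow> nilpotent_mat (A c x)"
    and v0_m0: "cross2 v0 m0 \<noteq> 0"
    and g_v0: "g l *v v0 = (l - \<alpha>) *s v0"
    and g_m0: "g l *v m0 = m0"
begin

lemma chart: "c \<in> At \<Longrightarrow> chart_map c"
  using surface by (rule riemann_surface_chart_map)

lemma P_sparse: "P sparse_in UNIV" and P_open: "open (- P)"
proof -
  show "P sparse_in UNIV" using frame by (simp add: lwr_frame_def)
  then show "open (- P)" by (rule sparse_open)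
qed

lemma det_\<Phi>: "x \<notin> P \<Longrightarrow> det (\<Phi> x l) = 1"
  using frame by (simp add: lwr_frame_def)

lemma mero_\<Phi>: "c \<in> At \<Longrightarrow> mero_mat c P (\<lambda>x. \<Phi> x l)"
  using frame by (rule mero_frame)

lemma \<Phi>_entire: "x \<notin> P \<Longrightarrow> (\<lambda>l. \<Phi> x l $ i $ j) holomorphic_on UNIV"
  using frame by (simp add: lwr_frame_def)

lemma trace_A: "c \<in> At \<Longrightarrow> x \<in> fst c \<Longrightarrow> x \<notin> P \<Longrightarrow> trace (A c x) = 0"
  and trace_C: "c \<in> At \<Longrightarrow> x \<in> fst c \<Longrightarrow> x \<notin> P \<Longrightarrow> trace (C c x) = 0"
proof -
  assume x: "c \<in> At" "x \<in> fst c" "x \<notin> P"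
  have "trace (maurer_cartan \<Phi> c x l) = 0" for l
    using frame x unfolding lwr_frame_def lwr_potential_def by blast
  then have "trace (scale_mat (l - \<alpha>) (A c x) + C c x) = 0" for l
    by (simp add: potential[OF x])
  then have *: "(l - \<alpha>) * trace (A c x) + trace (C c x) = 0" for l
    by (simp add: trace_add trace_scale_mat)
  show "trace (C c x) = 0" using *[of \<alpha>] by simp
  then show "trace (A c x) = 0" using *[of "\<alpha> + 1"] by simp
qed

lemma A_A: "c \<in> At \<Longrightarrow> x \<in> fst c \<Longrightarrow> x \<notin> P \<Longrightarrow> A c x *v (A c x *v z) = 0"
  by (intro nilpotent_trace_0_sq nilpotent trace_A)

lemma potential_mult:
  "c \<in> At \<Longrightarrow> x \<in> fst c \<Longrightarrow> x \<notin> P \<Longrightarrow>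
     maurer_cartan \<Phi> c x l *v z = (l - \<alpha>) *s (A c x *v z) + C c x *v z"
  by (simp add: potential matrix_vector_mult_add_rdistrib scale_mat_mult_vec)

lemma A_transition:
  assumes "c \<in> At" "d \<in> At" "x \<in> fst c" "x \<in> fst d" "x \<notin> P"
  shows "A c x = scale_mat (dz c (snd d) x) (A d x)"
proof -
  have *: "maurer_cartan \<Phi> c x l = scale_mat (dz c (snd d) x) (maurer_cartan \<Phi> d x l)" for l
    using frame assms unfolding lwr_frame_def lwr_potential_def by blast
  have "A e x = maurer_cartan \<Phi> e x (\<alpha> + 1) - maurer_cartan \<Phi> e x \<alpha>" if "e \<in> At" "x \<in> fst e" for e
    using that assms(5) by (simp add: potential vec_eq_iff scale_mat_def)
  then have "A c x = maurer_cartan \<Phi> c x (\<alpha> + 1) - maurer_cartan \<Phi> c x \<alpha>"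
    "A d x = maurer_cartan \<Phi> d x (\<alpha> + 1) - maurer_cartan \<Phi> d x \<alpha>"
    using assms by auto
  then show ?thesis
    using *[of "\<alpha> + 1"] *[of \<alpha>] by (simp add: vec_eq_iff scale_mat_def right_diff_distrib)
qed

lemma dz_\<Phi>: "x \<notin> P \<Longrightarrow> dz_mat c (\<lambda>y. \<Phi> y l) x = \<Phi> x l ** maurer_cartan \<Phi> c x l"
  by (rule dz_frame[OF frame])

text \<open>The solution of \<open>\<Phi> x \<alpha> *v v x = v0\<close> by Cramer's rule. Polynomial entries make \<open>v\<close> meromorphic at
  the poles of the frame.\<close>

definition v :: "'a \<Rightarrow> complex^2" where
  "v x = (\<chi> i. if i = 1 then cross2 v0 (column 2 (\<Phi> x \<alpha>)) else cross2 (column 1 (\<Phi> x \<alpha>)) v0)"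

lemma \<Phi>_v:
  assumes "x \<notin> P"
  shows "\<Phi> x \<alpha> *v v x = v0"
proof -
  have "(\<Phi> x \<alpha> *v v x) $ i = det (\<Phi> x \<alpha>) * v0 $ i" for i
    using exhaust_2[of i] by (auto simp: mult_vec2 v_def det_2 cross2_def column_def algebra_simps)
  then show ?thesis by (simp add: vec_eq_iff det_\<Phi>[OF assms])
qed

lemma v_nonzero: "x \<notin> P \<Longrightarrow> v x \<noteq> 0"
  using \<Phi>_v[of x] v0_m0 by auto

lemma mero_v: "c \<in> At \<Longrightarrow> mero_vec c P v"
  using mero_\<Phi>[of c \<alpha>] unfolding mero_vec_def mero_mat_def v_def
  by (auto simp: forall_2 cross2_def column_def intro!: mero_off_intros)

text \<open>Differentiate \<open>\<Phi> x \<alpha> *v v x = v0\<close>; at \<open>l = \<alpha>\<close> the potential reduces to \<open>C\<close>.\<close>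

lemma dz_v:
  assumes "c \<in> At" "x \<in> fst c" "x \<notin> P"
  shows "dz_vec c v x = - (C c x *v v x)"
proof -
  have "0 = dz_vec c (\<lambda>y. \<Phi> y \<alpha> *v v y) x"
    using dz_vec_cong[OF chart[OF assms(1)] P_open, of x "\<lambda>y. \<Phi> y \<alpha> *v v y" "\<lambda>y. v0"] assms
    by (simp add: \<Phi>_v dz_vec_const)
  also have "\<dots> = \<Phi> x \<alpha> *v (C c x *v v x) + \<Phi> x \<alpha> *v dz_vec c v x"
    using assms mero_imp_holo[of c P] mero_\<Phi> mero_v
    by (subst dz_vec_mult[OF chart P_open])
       (auto simp: dz_\<Phi> matrix_vector_mul_assoc[symmetric] potential_mult)
  finally have "\<Phi> x \<alpha> *v (C c x *v v x + dz_vec c v x) = 0"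
    by (simp add: matrix_vector_right_distrib)
  then have "C c x *v v x + dz_vec c v x = 0"
    using det_1_mult_cancel[OF det_\<Phi>[OF assms(3)], of \<alpha> _ 0] by simp
  then show ?thesis by (simp add: add_eq_0_iff)
qed

text \<open>As \<open>A\<close> has square zero, \<open>w\<close> spans the kernel of \<open>A\<close> wherever it does not vanish. It
  depends on the coordinate only by a scalar factor.\<close>

definition w :: "'a chart \<Rightarrow> 'a \<Rightarrow> complex^2" where
  "w c x = A c x *v v x"

lemma mero_w: "c \<in> At \<Longrightarrow> mero_vec c P (w c)"
  unfolding w_def by (intro mero_vec_mult mero_A mero_v)

lemma A_w: "c \<in> At \<Longrightarrow> x \<in> fst c \<Longrightarrow> x \<notin> P \<Longrightarrow> A c x *v w c x = 0"
  by (simp add: w_def A_A)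

lemma w_transition:
  assumes "c \<in> At" "d \<in> At" "x \<in> fst c" "x \<in> fst d" "x \<notin> P"
  shows "w c x = dz c (snd d) x *s w d x"
  by (simp add: w_def A_transition[OF assms] scale_mat_mult_vec)

text \<open>With a spinor \<open>s\<close> this is \<open>- (cross2 v s)\<^sup>2\<close>. Off \<open>P\<close> it vanishes exactly where the
  two lines of the dressing factor fail to be defined and distinct.\<close>

definition \<delta> :: "'a chart \<Rightarrow> 'a \<Rightarrow> complex" where
  "\<delta> c x = cross2 (v x) (w c x)"

lemma mero_\<delta>: "c \<in> At \<Longrightarrow> mero_off c P (\<delta> c)"
  unfolding \<delta>_def by (intro mero_cross2 mero_v mero_w)

definition Q :: "'a set" where
  "Q = P \<union> {x. \<exists>c\<in>At. x \<in> fst c \<and> \<delta> c x = 0}"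

lemma P_Q: "P \<subseteq> Q" by (auto simp: Q_def)

lemma \<delta>_nonzero: "c \<in> At \<Longrightarrow> x \<in> fst c \<Longrightarrow> x \<notin> Q \<Longrightarrow> \<delta> c x \<noteq> 0"
  by (auto simp: Q_def)

lemma \<delta>_zero: 
  assumes "c \<in> At" "x \<in> fst c" "x \<in> Q" "x \<notin> P"
  shows "\<delta> c x = 0"
proof -
  obtain d where d: "d \<in> At" "x \<in> fst d" "\<delta> d x = 0" using assms by (auto simp: Q_def)
  then show ?thesis
    using w_transition[of c d x] assms by (simp add: \<delta>_def cross2_smult)
qed

definition G :: "'a \<Rightarrow> complex \<Rightarrow> complex^2^2" where
  "G x l = g l ** \<Phi> x l"

lemma mero_G: "c \<in> At \<Longrightarrow> mero_mat c P (\<lambda>x. G x l)"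
  unfolding G_def by (intro mero_mat_mult mero_mat_const mero_\<Phi>)

lemma dz_G:
  assumes "c \<in> At" "x \<in> fst c" "x \<notin> P"
  shows "dz_mat c (\<lambda>y. G y l) x = G x l ** maurer_cartan \<Phi> c x l"
  unfolding G_def
  using assms mero_imp_holo[of c P] mero_\<Phi>
  by (subst dz_mat_const_mult[OF chart P_open]) (auto simp: dz_\<Phi> matrix_mul_assoc)

lemma g_basis_map: "g l = basis_map v0 m0 ((l - \<alpha>) *s v0) m0"
  by (rule matrix_eq_on_basis[OF v0_m0]) (simp_all only: basis_map_apply[OF v0_m0] g_v0 g_m0)

lemma det_g: "det (g l) = l - \<alpha>"
  unfolding g_basis_map det_basis_map[OF v0_m0] using v0_m0 by (simp only: cross2_smult) simp

lemma det_G: "x \<notin> P \<Longrightarrow> det (G x l) = l - \<alpha>"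
  by (simp add: G_def det_mul det_g det_\<Phi>)

lemma G_v: "x \<notin> P \<Longrightarrow> G x \<alpha> *v v x = 0"
  by (simp add: G_def matrix_vector_mul_assoc[symmetric] \<Phi>_v g_v0)

lemma G_entire:
  assumes "x \<notin> P"
  shows "(\<lambda>l. (G x l *v z) $ i) holomorphic_on UNIV"
proof -
  have "(\<lambda>l. g l $ i $ j) holomorphic_on UNIV" for i j
    unfolding g_basis_map basis_map_def using v0_m0
    by (auto intro!: holomorphic_intros)
  then show ?thesis
    unfolding G_def mult_vec2 mult_mat2 using \<Phi>_entire[OF assms]
    by (intro holomorphic_intros)
qed

text \<open>The divided difference at \<open>\<alpha>\<close> of \<open>G x l *v v x\<close>, which vanishes at \<open>l = \<alpha>\<close>; so it is entire in
  \<open>l\<close>. It becomes the image of \<open>v\<close> under the dressed frame.\<close>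

definition u :: "'a \<Rightarrow> complex \<Rightarrow> complex^2" where
  "u x l = (\<chi> i. if l = \<alpha> then deriv (\<lambda>l. (G x l *v v x) $ i) \<alpha> else (G x l *v v x) $ i / (l - \<alpha>))"

lemma mult_u: "x \<notin> P \<Longrightarrow> (l - \<alpha>) *s u x l = G x l *v v x"
proof (cases "l = \<alpha>")
  case False
  then have "(l - \<alpha>) * u x l $ i = (G x l *v v x) $ i" for i
    by (simp add: u_def)
  then show ?thesis by (simp only: vec_eq_iff vector_smult_component) simp
qed (simp add: G_v)

lemma u_entire:
  assumes "x \<notin> P"
  shows "(\<lambda>l. u x l $ i) holomorphic_on UNIV"
  using pole_lemma_open[OF G_entire[OF assms, of "v x" i] open_UNIV, of \<alpha>]
  by (simp add: u_def G_v[OF assms] cong: if_cong)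

lemma mero_u:
  assumes "c \<in> At" "l \<noteq> \<alpha>"
  shows "mero_vec c P (\<lambda>x. u x l)"
proof -
  have "mero_vec c P (\<lambda>x. G x l *v v x)"
    using assms by (intro mero_vec_mult mero_G mero_v)
  then have "mero_off c P (\<lambda>x. inverse (l - \<alpha>) * (G x l *v v x) $ i)" for i
    by (auto simp: mero_vec_def intro!: mero_off_intros)
  then show ?thesis using assms(2) by (simp add: mero_vec_def u_def field_simps)
qed

text \<open>The terms with \<open>C\<close> cancel by \<open>dz_v\<close>, and the factor \<open>l - \<alpha>\<close> in front of \<open>A\<close> cancels the
  denominator of \<open>u\<close>.\<close>

lemma dz_u:
  assumes "c \<in> At" "x \<in> fst c" "x \<notin> P" "l \<noteq> \<alpha>"
  shows "dz_vec c (\<lambda>y. u y l) x = G x l *v w c x"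
proof -
  have eq: "u y l = inverse (l - \<alpha>) *s (G y l *v v y)" for y
    using assms(4) by (simp add: u_def vec_eq_iff field_simps)
  have H: "holo_mat c (- P) (\<lambda>y. G y l)" "holo_vec c (- P) v"
    using assms(1) by (auto intro: mero_imp_holo mero_G mero_v)
  have x: "x \<in> - P" using assms by simp
  note r = chart[OF assms(1)] P_open assms(2) x
  have "dz_vec c (\<lambda>y. G y l *v v y) x = (l - \<alpha>) *s (G x l *v w c x)"
    unfolding dz_vec_mult[OF r H] dz_G[OF assms(1-3)] dz_v[OF assms(1-3)]
    by (simp add: matrix_vector_mul_assoc[symmetric] potential_mult[OF assms(1-3)] w_def
        matrix_vector_right_distrib vector_scalar_commute
        matrix_vector_mult_diff_distrib[of _ 0, simplified] del: vector_sub_rdistrib)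
  then have "dz_vec c (\<lambda>y. inverse (l - \<alpha>) *s (G y l *v v y)) x = 
      (inverse (l - \<alpha>) * (l - \<alpha>)) *s (G x l *v w c x)"
    unfolding dz_vec_smult[OF r holo_vec_mult[OF H]] by (simp only: vector_smult_assoc)
  also have "\<dots> = G x l *v w c x" using assms(4) by simp
  finally have "dz_vec c (\<lambda>y. inverse (l - \<alpha>) *s (G y l *v v y)) x = G x l *v w c x" .
  then show ?thesis by (simp add: eq)
qed

text \<open>The coordinates of \<open>w' + C w\<close> in the basis \<open>v, w\<close>. They do not involve the spectral parameter.\<close>

definition coeff_v :: "'a chart \<Rightarrow> 'a \<Rightarrow> complex" where
  "coeff_v c x = cross2 (dz_vec c (w c) x + C c x *v w c x) (w c x) / \<delta> c x"

definition coeff_w :: "'a chart \<Rightarrow> 'a \<Rightarrow> complex" where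
  "coeff_w c x = cross2 (v x) (dz_vec c (w c) x + C c x *v w c x) / \<delta> c x"

lemma dz_w:
  assumes "c \<in> At" "x \<in> fst c" "x \<notin> Q"
  shows "dz_vec c (w c) x = coeff_v c x *s v x + coeff_w c x *s w c x - C c x *v w c x"
  using basis_decomposition[of "v x" "w c x" "dz_vec c (w c) x + C c x *v w c x"] \<delta>_nonzero[OF assms]
  unfolding coeff_v_def coeff_w_def by (simp add: \<delta>_def algebra_simps)

text \<open>Together with \<open>dz_u\<close> this is a linear system for \<open>u\<close> and \<open>G w\<close> in which the spectral
  parameter occurs in a single entry, and there linearly. Both the degree of the dressed potential
  and the estimate at \<open>l = \<alpha>\<close> rest on it.\<close>

lemma dz_Gw:
  assumes "c \<in> At" "x \<in> fst c" "x \<notin> Q"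
  shows "dz_vec c (\<lambda>y. G y l *v w c y) x = ((l - \<alpha>) * coeff_v c x) *s u x l + coeff_w c x *s (G x l *v w c x)"
proof -
  have xP: "x \<notin> P" using assms P_Q by auto
  have H: "holo_mat c (- P) (\<lambda>y. G y l)" "holo_vec c (- P) (w c)"
    using assms(1) by (auto intro: mero_imp_holo mero_G mero_w)
  have x: "x \<in> - P" using xP by simp
  note r = chart[OF assms(1)] P_open assms(2) x
  have "dz_vec c (\<lambda>y. G y l *v w c y) x = G x l *v (coeff_v c x *s v x + coeff_w c x *s w c x)"
    unfolding dz_vec_mult[OF r H] dz_G[OF assms(1,2) xP] dz_w[OF assms]
    by (simp add: matrix_vector_mul_assoc[symmetric] potential_mult[OF assms(1,2) xP] A_w[OF assms(1,2) xP]
        matrix_vector_right_distrib matrix_vector_mult_diff_distrib)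
  also have "\<dots> = coeff_v c x *s ((l - \<alpha>) *s u x l) + coeff_w c x *s (G x l *v w c x)"
    by (simp add: matrix_vector_right_distrib vector_scalar_commute mult_u[OF xP] del: vector_sub_rdistrib)
  finally show ?thesis by (simp add: vec_eq_iff algebra_simps)
qed

end

section \<open>The singular set\<close>

context lwr_dressing
begin

text \<open>The points near which \<open>Q\<close> has no other point and those near which everything else lies in \<open>Q\<close>
  form two disjoint open sets. They cover the surface because a meromorphic function vanishes
  identically or nowhere on a small punctured disc. Connectedness leaves only one of them.\<close>

lemma Q_sparse_of_\<delta>_nonzero:
  assumes "c0 \<in> At" "x0 \<in> fst c0" "x0 \<notin> P" "\<delta> c0 x0 \<noteq> 0"
  shows "Q sparse_in UNIV"
proof -
  define U1 where "U1 = {x. eventually (\<lambda>y. y \<notin> Q) (at x)}"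
  define U2 where "U2 = {x. eventually (\<lambda>y. y \<in> Q) (at x)}"
  have cover: "\<exists>c\<in>At. x \<in> fst c" for x
    using surface by (auto simp: riemann_surface_def)
  have U1I: "x \<in> U1" if c: "c \<in> At" "x \<in> fst c" and ev: "eventually (\<lambda>t. in_coord c (\<delta> c) t \<noteq> 0) (at (snd c x))" for c x
  proof -
    have "eventually (\<lambda>y. y \<notin> P) (at x)" using P_sparse by (rule sparse_eventually)
    with eventually_at_chart[OF chart[OF c(1)] c(2) ev]
    have "eventually (\<lambda>y. y \<notin> Q) (at x)"
    proof eventually_elim
      case (elim y)
      then show ?case using \<delta>_zero[OF c(1), of y] chart[OF c(1)] by (auto simp: in_coord_apply)
    qed
    then show ?thesis by (simp add: U1_def)
  qed
  have "x \<in> U1 \<union> U2" for x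
  proof -
    obtain c where c: "c \<in> At" "x \<in> fst c" using cover by blast
    have "in_coord c (\<delta> c) meromorphic_on {snd c x}"
      using mero_\<delta>[OF c(1)] c(2) by (auto simp: mero_off_def mero_in_chart_def elim: meromorphic_on_subset)
    then have "eventually (\<lambda>t. in_coord c (\<delta> c) t \<noteq> 0) (at (snd c x)) \<or> 
               eventually (\<lambda>t. in_coord c (\<delta> c) t = 0) (at (snd c x))"
      using non_zero_neighbour unfolding meromorphic_at_iff by (auto simp: frequently_def)
    then show ?thesis
    proof
      assume "eventually (\<lambda>t. in_coord c (\<delta> c) t = 0) (at (snd c x))"
      from eventually_at_chart[OF chart[OF c(1)] c(2) this]
      have "eventually (\<lambda>y. y \<in> Q) (at x)"
      proof eventually_elim
        case (elim y)
        then have "\<delta> c y = 0" using in_coord_apply[OF chart[OF c(1)], of y "\<delta> c"] by simp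
        then show ?case using c(1) elim by (auto simp: Q_def)
      qed
      then show ?thesis by (simp add: U2_def)
    qed (use U1I c in blast)
  qed
  moreover have "U1 \<inter> U2 = {}"
  proof -
    have False if "x \<in> U1" "x \<in> U2" for x
    proof -
      obtain c where c: "c \<in> At" "x \<in> fst c" using cover by blast
      have "eventually (\<lambda>y. False) (at x)"
        using that unfolding U1_def U2_def mem_Collect_eq by eventually_elim auto
      then show False
        using at_chart_neq_bot[OF chart[OF c(1)] c(2)] by (simp add: trivial_limit_def[symmetric] eventually_False)
    qed
    then show ?thesis by auto
  qed
  moreover have "open U1" "open U2" unfolding U1_def U2_def by (rule open_eventually_at)+
  moreover have "connected (UNIV :: 'a set)" using surface by (simp add: riemann_surface_def)
  ultimately have "U1 = {} \<or> U2 = {}"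
    using connectedD[of "UNIV :: 'a set" U1 U2] by auto
  moreover have "x0 \<in> U1"
  proof (rule U1I[OF assms(1,2)])
    have "holo_in_chart c0 (- P) (\<delta> c0)"
      using mero_\<delta>[OF assms(1)] by (simp add: mero_off_def)
    then have "isCont (in_coord c0 (\<delta> c0)) (snd c0 x0)"
      using has_dz[OF chart[OF assms(1)] P_open] assms(2,3) by (blast intro: DERIV_isCont)
    moreover have "in_coord c0 (\<delta> c0) (snd c0 x0) \<noteq> 0"
      using assms chart by (simp add: in_coord_apply)
    ultimately show "eventually (\<lambda>t. in_coord c0 (\<delta> c0) t \<noteq> 0) (at (snd c0 x0))"
      unfolding isCont_def using tendsto_imp_eventually_ne by blast
  qed
  ultimately have "U1 = UNIV" using \<open>\<And>x. x \<in> U1 \<union> U2\<close> by auto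
  then show ?thesis by (auto simp: sparse_in_eventually_iff U1_def)
qed

text \<open>If \<open>\<delta>\<close> vanishes on the domain of a spinor \<open>s\<close>, then \<open>s\<close> is parallel to \<open>v\<close>; differentiating
  \<open>cross2 v s = 0\<close> shows that \<open>C s + s'\<close> is parallel to \<open>v\<close> as well. But the determinant of
  \<open>\<Phi> s\<close> and \<open>(\<Phi> s)'\<close> is \<open>cross2 s (C s + s')\<close>, so the frame would be flat there.\<close>

lemma Q_sparse_of_not_flat:
  assumes "\<not> lwr_flat At P \<Phi>"
  shows "Q sparse_in UNIV"
proof -
  obtain c V s x l where c: "c \<in> At" and VP: "V \<subseteq> - P" and sp: "spinor (maurer_cartan \<Phi>) c V s" 
    and x: "x \<in> V"
    and nz: "det (transpose (vector [\<Phi> x l *v s x, dz_vec c (\<lambda>y. \<Phi> y l *v s y) x] :: complex^2^2)) \<noteq> 0"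
    using assms unfolding lwr_flat_def Let_def by blast
  have V: "open V" "V \<subseteq> fst c" and s: "holo_vec c V s"
    using sp by (auto simp: spinor_def holo_vec_def)
  obtain B where B: "\<And>y l. y \<in> V \<Longrightarrow> 
       maurer_cartan \<Phi> c y l = scale_mat l (\<chi> i j. s y $ i * perp (s y) $ j) + B y"
    using sp by (auto simp: spinor_def)
  have A: "A c y *v z = cross2 (s y) z *s s y" if y: "y \<in> V" for y z
  proof -
    have yP: "y \<in> fst c" "y \<notin> P" using y V VP by auto
    have "scale_mat 1 (A c y) + C c y - (scale_mat 0 (A c y) + C c y) = 
        scale_mat (\<alpha> + 1) (\<chi> i j. s y $ i * perp (s y) $ j) + B y - 
        (scale_mat \<alpha> (\<chi> i j. s y $ i * perp (s y) $ j) + B y)"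
      using B[OF y, of "\<alpha> + 1"] B[OF y, of \<alpha>] potential[OF c yP, of "\<alpha> + 1"] potential[OF c yP, of \<alpha>]
      by simp
    then have "A c y $ i $ j = s y $ i * perp (s y) $ j" for i j
      by (simp add: vec_eq_iff scale_mat_def algebra_simps)
    then show ?thesis
      by (simp add: vec_eq_iff mult_vec2 perp_def cross2_def algebra_simps)
  qed
  have "\<exists>y\<in>V. \<delta> c y \<noteq> 0"
  proof (rule ccontr)
    assume "\<not> (\<exists>y\<in>V. \<delta> c y \<noteq> 0)"
    then have prod: "cross2 (s y) (v y) * cross2 (v y) (s y) = 0" if "y \<in> V" for y
      using that by (auto simp: \<delta>_def w_def A cross2_smult)
    have par: "cross2 (v y) (s y) = 0" if "y \<in> V" for y
      using prod[OF that] by (auto simp: cross2_def mult.commute)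
    have xf: "x \<in> fst c" "x \<notin> P" using x V VP by auto
    define z where "z = C c x *v s x + dz_vec c s x"
    note r = chart[OF c] V(1) xf(1) x
    have vV: "holo_vec c V v"
      using mero_imp_holo(1)[OF mero_v[OF c]] VP by (rule holo_vec_subset)
    have \<Phi>V: "holo_mat c V (\<lambda>y. \<Phi> y l)"
      using mero_imp_holo(2)[OF mero_\<Phi>[OF c]] VP by (rule holo_mat_subset)
    have "0 = dz c (\<lambda>y. cross2 (v y) (s y)) x"
      using dz_cong[OF r, of "\<lambda>y. cross2 (v y) (s y)" "\<lambda>y. 0"] par by (simp add: dz_const)
    also have "\<dots> = cross2 (v x) (dz_vec c s x) - cross2 (C c x *v v x) (s x)"
      by (simp add: dz_cross2[OF r vV s] dz_v[OF c xf]) (simp add: cross2_def algebra_simps)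
    also have "\<dots> = cross2 (v x) z"
      using cross2_trace[OF trace_C[OF c xf], of "v x" "s x"] by (simp add: z_def cross2_add algebra_simps add_eq_0_iff)
    finally have vz: "cross2 (v x) z = 0" by simp
    obtain k1 k2 where "s x = k1 *s v x" "z = k2 *s v x"
      using cross2_eq_0_imp_parallel v_nonzero[OF xf(2)] vz par[OF x] by metis
    then have "cross2 (s x) z = 0" by (simp add: cross2_smult)
    moreover have "dz_vec c (\<lambda>y. \<Phi> y l *v s y) x = \<Phi> x l *v z"
      unfolding dz_vec_mult[OF r \<Phi>V s] dz_\<Phi>[OF xf(2)]
      by (simp add: matrix_vector_mul_assoc[symmetric] potential_mult[OF c xf] A[OF x] z_def
          matrix_vector_right_distrib)
    moreover have "det (transpose (vector [a, b] :: complex^2^2)) = cross2 a b" for a b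
      by (simp add: det_2 transpose_def cross2_def)
    ultimately show False using nz cross2_mult[of "\<Phi> x l" "s x" z] by simp
  qed
  then show ?thesis using Q_sparse_of_\<delta>_nonzero[OF c] V VP by blast
qed

end

section \<open>The dressed frame\<close>

text \<open>Non-flatness enters the construction only through the discreteness of \<open>Q\<close>.\<close>

locale lwr_dressing_generic = lwr_dressing +
  assumes Q_sparse: "Q sparse_in UNIV"
begin

lemma Q_open: "open (- Q)" using Q_sparse by (rule sparse_open)

lemma Q_P: "x \<notin> Q \<Longrightarrow> x \<notin> P" using P_Q by auto

lemma mero_coeff_v: "c \<in> At \<Longrightarrow> mero_off c Q (coeff_v c)" and mero_coeff_w: "c \<in> At \<Longrightarrow> mero_off c Q (coeff_w c)"
proof -
  assume c: "c \<in> At"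
  have 1: "mero_vec c P (\<lambda>x. dz_vec c (w c) x + C c x *v w c x)"
    using c by (intro mero_vec_add mero_vec_dz chart P_sparse mero_vec_mult mero_C mero_w)
  show "mero_off c Q (coeff_v c)"  unfolding coeff_v_def
    using c \<delta>_nonzero
    by (intro mero_off_divide chart mero_off_mono[OF _ P_Q] mero_cross2 1 mero_w mero_\<delta>) auto
  show "mero_off c Q (coeff_w c)"  unfolding coeff_w_def
    using c \<delta>_nonzero
    by (intro mero_off_divide chart mero_off_mono[OF _ P_Q] mero_cross2 1 mero_v mero_\<delta>) auto
qed

text \<open>At \<open>l = \<alpha>\<close> the vector \<open>u\<close> is a derivative with respect to \<open>l\<close>, so neither its holomorphy in the
  coordinate nor its meromorphy at the poles is inherited from the frame. Both come from the
  values \<open>l n\<close> tending to \<open>\<alpha>\<close>: the linear system for \<open>u\<close> and \<open>G w\<close> yields the derivative \<open>G w\<close> in the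
  limit, and then \<open>u\<close> is a primitive of a meromorphic function.\<close>

lemma
  assumes c: "c \<in> At"
  shows mero_u_\<alpha>: "mero_vec c Q (\<lambda>x. u x \<alpha>)"
    and dz_u_\<alpha>: "\<And>x. x \<in> fst c \<Longrightarrow> x \<notin> Q \<Longrightarrow> dz_vec c (\<lambda>y. u y \<alpha>) x = G x \<alpha> *v w c x"
proof -
  note cm = chart[OF c]
  define \<epsilon> :: "nat \<Rightarrow> complex" where "\<epsilon> = (\<lambda>n. 1 / of_nat (Suc n))"
  define l where "l = (\<lambda>n. \<alpha> + \<epsilon> n)"
  have \<epsilon>: "\<epsilon> \<longlonglongrightarrow> 0" unfolding \<epsilon>_def
    using LIMSEQ_Suc[OF lim_1_over_n] by simp
  have l: "l n \<noteq> \<alpha>" "l n - \<alpha> = \<epsilon> n" for n by (simp_all add: l_def \<epsilon>_def del: of_nat_Suc)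
  have llim: "l \<longlonglongrightarrow> \<alpha>" unfolding l_def using tendsto_add[OF tendsto_const \<epsilon>, of \<alpha>] by simp
  have ent: "(\<lambda>n. F (l n)) \<longlonglongrightarrow> F \<alpha>" if "F holomorphic_on UNIV" for F :: "complex \<Rightarrow> complex"
  proof -
    have "isCont F \<alpha>" using holomorphic_on_imp_continuous_on[OF that] continuous_on_eq_continuous_at by blast
    then show ?thesis using llim isCont_tendsto_compose by blast
  qed
  have D: "(in_coord c (\<lambda>y. u y \<alpha> $ i) has_field_derivative (G x \<alpha> *v w c x) $ i) (at (snd c x))"
    if x: "x \<in> fst c" "x \<notin> Q" for x i
  proof -
    let ?U = "snd c ` (fst c \<inter> - Q)"
    have "(in_coord c (\<lambda>y. u y \<alpha> $ i) has_field_derivative in_coord c (\<lambda>y. (G y \<alpha> *v w c y) $ i) (snd c x)) (at (snd c x))"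
    proof (rule derivative_of_pointwise_limit[where U = ?U and \<epsilon> = \<epsilon> and b = "in_coord c (coeff_v c)" and d = "in_coord c (coeff_w c)"
          and X = "\<lambda>n. in_coord c (\<lambda>y. u y (l n) $ i)" and Y = "\<lambda>n. in_coord c (\<lambda>y. (G y (l n) *v w c y) $ i)"])
      show "open ?U" using cm Q_open by (rule chart_image_open)
      show "snd c x \<in> ?U" using x by auto
      show "continuous_on ?U (in_coord c (coeff_v c))" "continuous_on ?U (in_coord c (coeff_w c))"
        using mero_coeff_v[OF c] mero_coeff_w[OF c] 
        by (auto simp: mero_off_def holo_in_chart_def intro: holomorphic_on_imp_continuous_on)
      show "convergent \<epsilon>" using \<epsilon> by (auto simp: convergent_def)
    next
      fix n t assume "t \<in> ?U"
      then obtain y where y: "y \<in> fst c" "y \<notin> Q" "t = snd c y" by auto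
      have yP: "y \<notin> P" using y Q_P by auto
      have "holo_in_chart c (- P) (\<lambda>y. u y (l n) $ i)"
        using mero_imp_holo(1)[OF mero_u[OF c l(1)]] by (auto simp: holo_vec_def)
      from has_dz[OF cm P_open this y(1)] yP
      have "(in_coord c (\<lambda>y. u y (l n) $ i) has_field_derivative dz_vec c (\<lambda>y. u y (l n)) y $ i) (at t)"
        by (simp add: y dz_vec_def)
      then show "(in_coord c (\<lambda>y. u y (l n) $ i) has_field_derivative in_coord c (\<lambda>y. (G y (l n) *v w c y) $ i) t) (at t)"
        using y cm by (simp add: dz_u[OF c y(1) yP l(1)] in_coord_apply)
      have "holo_in_chart c (- P) (\<lambda>y. (G y (l n) *v w c y) $ i)"
        using mero_imp_holo(1)[OF mero_vec_mult[OF mero_G[OF c] mero_w[OF c]]] by (auto simp: holo_vec_def)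
      from has_dz[OF cm P_open this y(1)] yP
      have "(in_coord c (\<lambda>y. (G y (l n) *v w c y) $ i) has_field_derivative
         dz_vec c (\<lambda>y. G y (l n) *v w c y) y $ i) (at t)"
        by (simp add: y dz_vec_def)
      then show "(in_coord c (\<lambda>y. (G y (l n) *v w c y) $ i) has_field_derivative
         \<epsilon> n * in_coord c (coeff_v c) t * in_coord c (\<lambda>y. u y (l n) $ i) t +
         in_coord c (coeff_w c) t * in_coord c (\<lambda>y. (G y (l n) *v w c y) $ i) t) (at t)"
        using y cm by (simp add: dz_Gw[OF c y(1,2)] in_coord_apply l)
    next
      fix t assume "t \<in> ?U"
      then obtain y where y: "y \<in> fst c" "y \<notin> Q" "t = snd c y" by auto
      have yP: "y \<notin> P" using y Q_P by auto
      show "(\<lambda>n. in_coord c (\<lambda>y. u y (l n) $ i) t) \<longlonglongrightarrow> in_coord c (\<lambda>y. u y \<alpha> $ i) t"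
        using ent[OF u_entire[OF yP]] y cm by (simp add: in_coord_apply)
      show "(\<lambda>n. in_coord c (\<lambda>y. (G y (l n) *v w c y) $ i) t) \<longlonglongrightarrow> in_coord c (\<lambda>y. (G y \<alpha> *v w c y) $ i) t"
        using ent[OF G_entire[OF yP]] y cm by (simp add: in_coord_apply)
    qed
    then show ?thesis using x cm by (simp add: in_coord_apply)
  qed
  show dz: "dz_vec c (\<lambda>y. u y \<alpha>) x = G x \<alpha> *v w c x" if "x \<in> fst c" "x \<notin> Q" for x
    using DERIV_imp_deriv[OF D[OF that]] by (simp add: vec_eq_iff dz_vec_def dz_def)
  show "mero_vec c Q (\<lambda>x. u x \<alpha>)"
    unfolding mero_vec_def
  proof
    fix i
    show "mero_off c Q (\<lambda>x. u x \<alpha> $ i)"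
    proof (rule mero_off_primitive[OF cm Q_sparse])
      show "holo_in_chart c (- Q) (\<lambda>x. u x \<alpha> $ i)"
        using D by (intro holo_in_chartI[OF cm Q_open]) auto
      show "mero_off c Q (\<lambda>x. (G x \<alpha> *v w c x) $ i)"
        using mero_vec_mult[OF mero_G[OF c] mero_w[OF c]] mero_off_mono[OF _ P_Q]
        by (auto simp: mero_vec_def)
      show "dz c (\<lambda>x. u x \<alpha> $ i) x = (G x \<alpha> *v w c x) $ i" if "x \<in> fst c" "x \<notin> Q" for x
        using dz[OF that] by (simp add: vec_eq_iff dz_vec_def)
    qed
  qed
qed

text \<open>The factor and the frame are global, but \<open>w\<close> needs a coordinate; by \<open>h_in_chart\<close> and
  \<open>\<Psi>_in_chart\<close>, every chart around the point gives the same result.\<close>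

definition chart_at :: "'a \<Rightarrow> 'a chart" where
  "chart_at x = (SOME c. c \<in> At \<and> x \<in> fst c)"

lemma chart_at: "chart_at x \<in> At" "x \<in> fst (chart_at x)"
proof -
  have "\<exists>c. c \<in> At \<and> x \<in> fst c" using surface unfolding riemann_surface_def by blast
  then have "chart_at x \<in> At \<and> x \<in> fst (chart_at x)" unfolding chart_at_def by (rule someI_ex)
  then show "chart_at x \<in> At" "x \<in> fst (chart_at x)" by auto
qed

definition h :: "'a \<Rightarrow> complex \<Rightarrow> complex^2^2" where
  "h x l = basis_map (v x) (w (chart_at x) x) ((l - \<alpha>) *s v x) (w (chart_at x) x)"

text \<open>Off \<open>l = \<alpha>\<close> this is \<open>G\<close> times the inverse of \<open>h\<close>; it is written by its values on \<open>v\<close> and \<open>w\<close> to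
  be defined at \<open>l = \<alpha>\<close> too.\<close>

definition \<Psi> :: "'a \<Rightarrow> complex \<Rightarrow> complex^2^2" where
  "\<Psi> x l = basis_map (v x) (w (chart_at x) x) (u x l) (G x l *v w (chart_at x) x)"

lemma v_w_basis: "c \<in> At \<Longrightarrow> x \<in> fst c \<Longrightarrow> x \<notin> Q \<Longrightarrow> cross2 (v x) (w c x) \<noteq> 0"
  using \<delta>_nonzero by (simp add: \<delta>_def)

text \<open>Passing to another chart multiplies \<open>w\<close>, and with it \<open>G w\<close>, by a nonzero scalar.\<close>

lemma
  assumes "c \<in> At" "x \<in> fst c" "x \<notin> Q"
  shows h_in_chart: "h x l = basis_map (v x) (w c x) ((l - \<alpha>) *s v x) (w c x)"
    and \<Psi>_in_chart: "\<Psi> x l = basis_map (v x) (w c x) (u x l) (G x l *v w c x)"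
proof -
  define t where "t = dz c (snd (chart_at x)) x"
  have w: "w c x = t *s w (chart_at x) x"
    unfolding t_def using assms chart_at Q_P by (intro w_transition) auto
  then have t: "t \<noteq> 0" using v_w_basis[OF assms] by (auto simp: cross2_smult)
  show "h x l = basis_map (v x) (w c x) ((l - \<alpha>) *s v x) (w c x)"
    and "\<Psi> x l = basis_map (v x) (w c x) (u x l) (G x l *v w c x)"
    unfolding w h_def \<Psi>_def by (simp_all only: basis_map_scale[OF t] vector_scalar_commute)
qed

lemma
  assumes "c \<in> At" "x \<in> fst c" "x \<notin> Q"
  shows h_v: "h x l *v v x = (l - \<alpha>) *s v x" and h_w: "h x l *v w c x = w c x"
    and \<Psi>_v: "\<Psi> x l *v v x = u x l" and \<Psi>_w: "\<Psi> x l *v w c x = G x l *v w c x"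
  unfolding h_in_chart[OF assms] \<Psi>_in_chart[OF assms]
  using basis_map_apply[OF v_w_basis[OF assms]] by auto

lemma h_simple_factor: "z_dependent_simple_factor (- Q) h"
  unfolding z_dependent_simple_factor_def
proof (intro exI ballI)
  fix x assume "x \<in> - Q"
  then show "is_SF ((\<lambda>x. \<alpha>) x) ((\<lambda>x. vec.span {v x}) x) ((\<lambda>x. vec.span {w (chart_at x) x}) x) (h x)"
    using is_SF_basis_map[OF v_w_basis[OF chart_at], of x \<alpha>] unfolding h_def by auto
qed

lemma \<Psi>_h:
  assumes "x \<notin> Q"
  shows "\<Psi> x l ** h x l = G x l"
  using chart_at[of x] assms Q_P[OF assms]
  by (intro matrix_eq_on_basis[OF v_w_basis[of "chart_at x" x]])
     (auto simp: matrix_vector_mul_assoc[symmetric] h_v h_w \<Psi>_v \<Psi>_w vector_scalar_commute mult_u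
        simp del: vector_sub_rdistrib)

text \<open>For \<open>l \<noteq> \<alpha>\<close> the determinants of \<open>G\<close> and \<open>h\<close> are both \<open>l - \<alpha>\<close>; the value at \<open>\<alpha>\<close>
  follows because both sides are entire in \<open>l\<close>.\<close>

lemma det_\<Psi>:
  assumes "x \<notin> Q"
  shows "det (\<Psi> x l) = 1"
proof -
  let ?w = "w (chart_at x) x"
  have nz: "cross2 (v x) ?w \<noteq> 0" using v_w_basis chart_at assms by blast
  have xP: "x \<notin> P" using assms by (rule Q_P)
  have *: "cross2 (u x l) (G x l *v ?w) = cross2 (v x) ?w" if "l \<noteq> \<alpha>" for l
  proof -
    have "(l - \<alpha>) * cross2 (u x l) (G x l *v ?w) = cross2 (G x l *v v x) (G x l *v ?w)"
      by (simp add: mult_u[OF xP, symmetric] cross2_smult del: vector_sub_rdistrib)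
    also have "\<dots> = (l - \<alpha>) * cross2 (v x) ?w" by (simp add: cross2_mult det_G[OF xP])
    finally show ?thesis using that by simp
  qed
  moreover have "cross2 (u x \<alpha>) (G x \<alpha> *v ?w) = cross2 (v x) ?w"
    by (rule entire_agree_at[of "\<lambda>l. cross2 (u x l) (G x l *v ?w)" "\<lambda>l. cross2 (v x) ?w"])
       (use * in \<open>auto simp: cross2_def intro!: holomorphic_intros u_entire[OF xP] G_entire[OF xP]\<close>)
  ultimately have "cross2 (u x l) (G x l *v ?w) = cross2 (v x) ?w" by (cases "l = \<alpha>") auto
  then show ?thesis unfolding \<Psi>_def by (simp add: det_basis_map nz)
qed

lemma mero_u_Q: "c \<in> At \<Longrightarrow> mero_vec c Q (\<lambda>x. u x l)"
  using mero_u_\<alpha>[of c] mero_u[of c l] mero_off_mono[OF _ P_Q]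
  by (cases "l = \<alpha>") (auto simp: mero_vec_def)

lemma dz_u_Q:
  "c \<in> At \<Longrightarrow> x \<in> fst c \<Longrightarrow> x \<notin> Q \<Longrightarrow> dz_vec c (\<lambda>y. u y l) x = G x l *v w c x"
  using dz_u_\<alpha> dz_u Q_P by (cases "l = \<alpha>") auto

lemma mero_Q: "mero_vec c P a \<Longrightarrow> mero_vec c Q a" "mero_mat c P F \<Longrightarrow> mero_mat c Q F"
  by (auto simp: mero_vec_def mero_mat_def intro: mero_off_mono[OF _ P_Q])

lemma mero_\<Psi>:
  assumes c: "c \<in> At"
  shows "mero_mat c Q (\<lambda>x. \<Psi> x l)"
proof (rule mero_mat_cong[OF chart[OF c] Q_sparse])
  show "mero_mat c Q (\<lambda>x. basis_map (v x) (w c x) (u x l) (G x l *v w c x))"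
    using c by (intro mero_basis_map chart mero_Q mero_v mero_w mero_u_Q mero_vec_mult mero_G v_w_basis)
  show "basis_map (v x) (w c x) (u x l) (G x l *v w c x) = \<Psi> x l" if "x \<in> fst c" "x \<notin> Q" for x
    using \<Psi>_in_chart[OF c that] by simp
qed

lemma \<Psi>_entire:
  assumes "x \<notin> Q"
  shows "(\<lambda>l. \<Psi> x l $ i $ j) holomorphic_on UNIV"
proof -
  have nz: "cross2 (v x) (w (chart_at x) x) \<noteq> 0" using v_w_basis chart_at assms by blast
  show ?thesis
    unfolding \<Psi>_def basis_map_def vec_lambda_beta
    using nz Q_P[OF assms] by (intro holomorphic_intros u_entire G_entire) auto
qed

text \<open>The coefficient of \<open>l\<close> in the dressed potential. It is a multiple of \<open>v\<close> times \<open>perp v\<close>, so \<open>v\<close>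
  is, up to scale, the new spinor where this coefficient does not vanish.\<close>

definition A_dressed :: "'a chart \<Rightarrow> 'a \<Rightarrow> complex^2^2" where
  "A_dressed c x = basis_map (v x) (w c x) 0 (coeff_v c x *s v x)"

text \<open>Differentiate \<open>\<Psi> v = u\<close> and \<open>\<Psi> w = G w\<close>. At \<open>l = \<alpha> + 1\<close> both simple factors
  are the identity, so the potential there is the old one; this is why the affine function is
  expanded at that value.\<close>

lemma maurer_cartan_\<Psi>:
  assumes c: "c \<in> At" and x: "x \<in> fst c" "x \<notin> Q"
  shows "maurer_cartan \<Psi> c x l = scale_mat (l - \<alpha> - 1) (A_dressed c x) + (A c x + C c x)"
    (is "_ = ?\<eta>")
proof -
  have xP: "x \<notin> P" using x(2) by (rule Q_P)
  have xQ: "x \<in> - Q" using x by simp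
  note nz = v_w_basis[OF c x] and r = chart[OF c] Q_open x(1) xQ
  have A_dressed: "A_dressed c x *v v x = 0" "A_dressed c x *v w c x = coeff_v c x *s v x"
    unfolding A_dressed_def using basis_map_apply[OF nz] by auto
  have \<eta>: "?\<eta> *v z = (l - \<alpha> - 1) *s (A_dressed c x *v z) + (A c x *v z + C c x *v z)" for z
    by (simp only: matrix_vector_mult_add_rdistrib scale_mat_mult_vec)
  have H: "holo_mat c (- Q) (\<lambda>y. \<Psi> y l)" "holo_vec c (- Q) v" "holo_vec c (- Q) (w c)"
    using mero_imp_holo(2)[OF mero_\<Psi>[OF c]] mero_imp_holo(1)[OF mero_Q(1)[OF mero_v[OF c]]]
      mero_imp_holo(1)[OF mero_Q(1)[OF mero_w[OF c]]] by auto
  have "dz_mat c (\<lambda>y. \<Psi> y l) x = \<Psi> x l ** ?\<eta>"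
  proof (rule matrix_eq_on_basis[OF nz])
    have "G x l *v w c x = dz_vec c (\<lambda>y. \<Psi> y l *v v y) x"
      using dz_vec_cong[OF r, of "\<lambda>y. \<Psi> y l *v v y" "\<lambda>y. u y l"] dz_u_Q[OF c x] \<Psi>_v[OF c] by simp
    also have "\<dots> = dz_mat c (\<lambda>y. \<Psi> y l) x *v v x - \<Psi> x l *v (C c x *v v x)"
      unfolding dz_vec_mult[OF r H(1,2)] dz_v[OF c x(1) xP]
      by (simp add: matrix_vector_mult_diff_distrib[of _ 0, simplified])
    finally have "dz_mat c (\<lambda>y. \<Psi> y l) x *v v x = \<Psi> x l *v w c x + \<Psi> x l *v (C c x *v v x)"
      by (simp add: \<Psi>_w[OF c x])
    then show "dz_mat c (\<lambda>y. \<Psi> y l) x *v v x = \<Psi> x l ** ?\<eta> *v v x"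
      by (simp only: matrix_vector_mul_assoc[symmetric] \<eta> A_dressed w_def[symmetric] matrix_vector_right_distrib) simp
    have "((l - \<alpha>) * coeff_v c x) *s u x l + coeff_w c x *s (G x l *v w c x) = dz_vec c (\<lambda>y. \<Psi> y l *v w c y) x"
      using dz_vec_cong[OF r, of "\<lambda>y. \<Psi> y l *v w c y" "\<lambda>y. G y l *v w c y"] dz_Gw[OF c x] \<Psi>_w[OF c] by simp
    also have "\<dots> = dz_mat c (\<lambda>y. \<Psi> y l) x *v w c x + 
        (coeff_v c x *s u x l + coeff_w c x *s (G x l *v w c x) - \<Psi> x l *v (C c x *v w c x))"
      unfolding dz_vec_mult[OF r H(1,3)] dz_w[OF c x]
      by (simp only: matrix_vector_mult_diff_distrib matrix_vector_right_distrib 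
          vector_scalar_commute \<Psi>_v[OF c x] \<Psi>_w[OF c x])
    finally have "dz_mat c (\<lambda>y. \<Psi> y l) x *v w c x = 
        ((l - \<alpha> - 1) * coeff_v c x) *s u x l + \<Psi> x l *v (C c x *v w c x)"
      by (simp add: vec_eq_iff algebra_simps)
    also have "((l - \<alpha> - 1) * coeff_v c x) *s u x l = \<Psi> x l *v ((l - \<alpha> - 1) *s (coeff_v c x *s v x))"
      by (simp only: vector_scalar_commute \<Psi>_v[OF c x] vector_smult_assoc)
    finally show "dz_mat c (\<lambda>y. \<Psi> y l) x *v w c x = \<Psi> x l ** ?\<eta> *v w c x"
      by (simp only: matrix_vector_mul_assoc[symmetric] \<eta> A_dressed A_w[OF c x(1) xP] 
           matrix_vector_right_distrib add_0_left)
  qed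
  moreover have "matrix_inv (\<Psi> x l) ** (\<Psi> x l ** M) = M" for M :: "complex^2^2"
    using invertible_matrix_inv(1)[OF det_1_invertible[OF det_\<Psi>[OF x(2)]]]
    by (simp add: matrix_mul_assoc)
  ultimately show ?thesis by (simp add: maurer_cartan_def)
qed

lemma mero_A_dressed: "c \<in> At \<Longrightarrow> mero_mat c Q (A_dressed c)"
proof -
  assume c: "c \<in> At"
  have "mero_vec c Q (\<lambda>x. coeff_v c x *s v x)"
    using mero_Q(1)[OF mero_v[OF c]] mero_coeff_v[OF c] by (auto simp: mero_vec_def intro!: mero_off_intros)
  moreover have "mero_vec c Q (\<lambda>x. 0)" by (auto simp: mero_vec_def intro!: mero_off_intros)
  ultimately show ?thesis
    unfolding A_dressed_def
    using mero_basis_map[OF chart[OF c] mero_Q(1)[OF mero_v[OF c]] mero_Q(1)[OF mero_w[OF c]] _ _ v_w_basis[OF c]]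
    by blast
qed

lemma lwr_frame_\<Psi>: "lwr_frame At Q \<Psi>"
proof -
  have "lwr_potential At Q (maurer_cartan \<Psi>)"
    unfolding lwr_potential_def
  proof (intro conjI ballI allI Q_sparse)
    fix c e x l assume c: "c \<in> At" "e \<in> At" and x: "x \<in> fst c \<inter> fst e - Q"
    have "holo_in_chart e (- Q) (\<lambda>y. \<Psi> y l $ i $ j)" for i j
      using mero_\<Psi>[OF c(2)] by (auto simp: mero_mat_def mero_off_def)
    then have "dz_mat c (\<lambda>y. \<Psi> y l) x = scale_mat (dz c (snd e) x) (dz_mat e (\<lambda>y. \<Psi> y l) x)"
      using dz_chain[OF surface c Q_open] x by (simp add: vec_eq_iff dz_mat_def scale_mat_def)
    then show "maurer_cartan \<Psi> c x l = scale_mat (dz c (snd e) x) (maurer_cartan \<Psi> e x l)"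
      by (simp add: maurer_cartan_def mult_scale_mat)
  next
    fix c x l assume c: "c \<in> At" and x: "x \<in> fst c - Q"
    have "trace (A_dressed c x) = 0"
      unfolding A_dressed_def using v_w_basis[OF c] x by (intro trace_basis_map_shear) auto
    moreover have "trace (A c x) = 0" "trace (C c x) = 0"
      using trace_A[OF c] trace_C[OF c] x Q_P by auto
    ultimately show "trace (maurer_cartan \<Psi> c x l) = 0"
      using maurer_cartan_\<Psi>[OF c, of x l] x
      by (simp add: trace_add trace_scale_mat)
  next
    fix c assume c: "c \<in> At"
    let ?B = "\<lambda>x. scale_mat (- \<alpha> - 1) (A_dressed c x) + (A c x + C c x)"
    have A: "mero_mat c Q (A_dressed c)" using c by (rule mero_A_dressed)
    have B: "mero_mat c Q ?B"
      using A mero_Q(2)[OF mero_A[OF c]] mero_Q(2)[OF mero_C[OF c]]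
      by (auto simp: mero_mat_def scale_mat_def intro!: mero_off_intros)
    have nil: "nilpotent_mat (A_dressed c x)" if "x \<in> fst c" "x \<notin> Q" for x
    proof (rule sq_0_imp_nilpotent)
      note nz = v_w_basis[OF c that]
      have A_dressed: "A_dressed c x *v v x = 0" "A_dressed c x *v w c x = coeff_v c x *s v x"
        unfolding A_dressed_def using basis_map_apply[OF nz] by auto
      show "A_dressed c x ** A_dressed c x = 0"
        by (rule matrix_eq_on_basis[OF nz]) 
           (simp_all add: matrix_vector_mul_assoc[symmetric] A_dressed vector_scalar_commute)
    qed
    have eq: "maurer_cartan \<Psi> c x l = scale_mat l (A_dressed c x) + ?B x" if "x \<in> fst c" "x \<notin> Q" for x l
      unfolding maurer_cartan_\<Psi>[OF c that] by (simp add: vec_eq_iff scale_mat_def algebra_simps)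
    show "\<exists>A B. (\<forall>i j. holo_in_chart c (- Q) (\<lambda>x. A x $ i $ j) \<and> mero_in_chart c (\<lambda>x. A x $ i $ j)) \<and>
        (\<forall>i j. holo_in_chart c (- Q) (\<lambda>x. B x $ i $ j) \<and> mero_in_chart c (\<lambda>x. B x $ i $ j)) \<and>
        (\<forall>x \<in> fst c - Q. nilpotent_mat (A x)) \<and>
        (\<forall>x \<in> fst c - Q. \<forall>l. maurer_cartan \<Psi> c x l = scale_mat l (A x) + B x)"
      using A B nil eq unfolding mero_mat_def mero_off_def
      by (intro exI[of _ "A_dressed c"] exI[of _ ?B]) blast
  qed
  then show ?thesis
    unfolding lwr_frame_def using Q_sparse det_\<Psi> \<Psi>_entire mero_\<Psi>
    unfolding mero_mat_def mero_off_def by blast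
qed

lemma dresses_h: "dresses_to_lwr_frame At P \<Phi> g Q h"
  unfolding dresses_to_lwr_frame_def
proof (intro conjI P_Q exI ballI allI impI)
  show "lwr_frame At Q \<Psi>" by (rule lwr_frame_\<Psi>)
  fix x l assume x: "x \<in> - Q" and inv: "invertible (h x l)"
  have "\<Psi> x l = \<Psi> x l ** (h x l ** matrix_inv (h x l))"
    by (simp add: invertible_matrix_inv(2)[OF inv])
  also have "\<dots> = g l ** \<Phi> x l ** matrix_inv (h x l)"
    using \<Psi>_h[of x l] x by (simp add: matrix_mul_assoc G_def)
  finally show "\<Psi> x l = g l ** \<Phi> x l ** matrix_inv (h x l)" .
qed

end

section \<open>Uniqueness of the dressing factor\<close>

context lwr_dressing_generic
begin

lemma G_kernel:
  assumes x: "x \<notin> P" and z: "G x \<alpha> *v z = 0"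
  obtains k where "z = k *s v x"
proof -
  define q where "q = cross2 v0 (\<Phi> x \<alpha> *v z) / cross2 v0 m0"
  define p where "p = cross2 (\<Phi> x \<alpha> *v z) m0 / cross2 v0 m0"
  have \<Phi>z: "\<Phi> x \<alpha> *v z = p *s v0 + q *s m0"
    unfolding p_def q_def by (rule basis_decomposition[OF v0_m0])
  have "0 = g \<alpha> *v (\<Phi> x \<alpha> *v z)" using z by (simp add: G_def matrix_vector_mul_assoc)
  also have "\<dots> = q *s m0"
    unfolding \<Phi>z by (simp add: matrix_vector_right_distrib vector_scalar_commute g_v0 g_m0)
  finally have "q = 0" using v0_m0 by auto
  then have "\<Phi> x \<alpha> *v z = \<Phi> x \<alpha> *v (p *s v x)"
    using \<Phi>z \<Phi>_v[OF x] by (simp add: vector_scalar_commute)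
  then have "z = p *s v x" by (rule det_1_mult_cancel[OF det_\<Phi>[OF x]])
  then show ?thesis using that by blast
qed

text \<open>Let \<open>\<Omega>\<close> be the frame that \<open>h'\<close> produces, so that \<open>\<Omega> h' = G\<close>. Determinants show that
  the spectral value of \<open>h'\<close> is \<open>\<alpha>\<close>. At \<open>l = \<alpha>\<close> the first line of \<open>h'\<close> lies in the kernel of \<open>G\<close>,
  hence is spanned by \<open>v\<close>, and \<open>\<Omega> v = u\<close>. Differentiating this and comparing the terms linear in
  \<open>l\<close>, the vector \<open>v\<close> is an eigenvector of the nilpotent coefficient of \<open>l\<close> in the potential of \<open>\<Omega>\<close>.
  The eigenvalue, which is therefore zero, is the component \<open>p\<close> of \<open>w\<close> along the first line; so \<open>w\<close>
  spans the second line.\<close>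

lemma h_unique:
  assumes sf: "z_dependent_simple_factor (- Q') h'"
    and dr: "dresses_to_lwr_frame At P \<Phi> g Q' h'"
    and x: "x \<notin> Q" "x \<notin> Q'"
  shows "h' x = h x"
proof -
  obtain \<beta> L M where SF: "\<And>y. y \<notin> Q' \<Longrightarrow> is_SF (\<beta> y) (L y) (M y) (h' y)"
    using sf unfolding z_dependent_simple_factor_def by auto
  obtain \<Omega> where PQ': "P \<subseteq> Q'" and fr: "lwr_frame At Q' \<Omega>"
    and \<Omega>: "\<And>y l. y \<notin> Q' \<Longrightarrow> invertible (h' y l) \<Longrightarrow> \<Omega> y l = g l ** \<Phi> y l ** matrix_inv (h' y l)"
    using dr unfolding dresses_to_lwr_frame_def by auto
  have "Q' sparse_in UNIV" using fr by (simp add: lwr_frame_def)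
  then have Q'o: "open (- Q')" by (rule sparse_open)
  have det\<Omega>: "det (\<Omega> y l) = 1" if "y \<notin> Q'" for y l using fr that by (simp add: lwr_frame_def)
  have eig: "\<exists>b'. cross2 (v y) b' \<noteq> 0 \<and> (\<forall>l. h' y l *v v y = (l - \<alpha>) *s v y) \<and>
      (\<forall>l. h' y l *v b' = b') \<and> (\<forall>l. l \<noteq> \<alpha> \<longrightarrow> \<Omega> y l ** h' y l = G y l)" if y: "y \<notin> Q'" for y
  proof -
    have yP: "y \<notin> P" using y PQ' by auto
    obtain a b' where ab: "cross2 a b' \<noteq> 0" "\<And>l. h' y l *v a = (l - \<beta> y) *s a" "\<And>l. h' y l *v b' = b'"
      using is_SF_eigenbasis[OF SF[OF y]] by blast
    have hb: "h' y l = basis_map a b' ((l - \<beta> y) *s a) b'" for l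
      by (rule eq_basis_map[OF ab])
    have deth: "det (h' y l) = l - \<beta> y" for l
      unfolding hb det_basis_map[OF ab(1)] using ab(1) by (simp only: cross2_smult) simp
    have \<Omega>h: "\<Omega> y l ** h' y l = G y l" if "l \<noteq> \<beta> y" for l
    proof -
      have inv: "invertible (h' y l)" using deth that by (simp add: invertible_det_nz)
      have "\<Omega> y l ** h' y l = G y l ** (matrix_inv (h' y l) ** h' y l)"
        unfolding \<Omega>[OF y inv] by (simp add: G_def matrix_mul_assoc)
      then show ?thesis by (simp add: invertible_matrix_inv(1)[OF inv])
    qed
    have \<beta>: "\<beta> y = \<alpha>"
    proof -
      have "det (\<Omega> y (\<beta> y + 1)) * det (h' y (\<beta> y + 1)) = det (G y (\<beta> y + 1))"
        using \<Omega>h[of "\<beta> y + 1"] by (simp flip: det_mul)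
      then show ?thesis by (simp add: det\<Omega>[OF y] deth det_G[OF yP])
    qed
    have "(\<Omega> y \<alpha> ** h' y \<alpha>) $ i $ j = G y \<alpha> $ i $ j" for i j
    proof (rule entire_agree_at[of "\<lambda>l. (\<Omega> y l ** h' y l) $ i $ j" "\<lambda>l. G y l $ i $ j"])
      have "(\<lambda>l. h' y l $ i $ j) holomorphic_on UNIV" for i j
        unfolding hb basis_map_def using ab(1) by (auto intro!: holomorphic_intros)
      moreover have "(\<lambda>l. \<Omega> y l $ i $ j) holomorphic_on UNIV" for i j
        using fr y by (simp add: lwr_frame_def)
      ultimately show "(\<lambda>l. (\<Omega> y l ** h' y l) $ i $ j) holomorphic_on UNIV"
        unfolding mult_mat2 by (intro holomorphic_intros)
      have "(\<lambda>l. (G y l *v axis j 1) $ i) holomorphic_on UNIV" using yP by (rule G_entire)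
      then show "(\<lambda>l. G y l $ i $ j) holomorphic_on UNIV"
        using exhaust_2[of j] by (auto simp: mult_vec2)
    qed (use \<Omega>h \<beta> in auto)
    then have "\<Omega> y \<alpha> ** h' y \<alpha> = G y \<alpha>" by (simp add: vec_eq_iff)
    then have "G y \<alpha> *v a = \<Omega> y \<alpha> *v (h' y \<alpha> *v a)" by (simp add: matrix_vector_mul_assoc)
    then have "G y \<alpha> *v a = 0" by (simp add: ab \<beta>)
    then obtain k where k: "a = k *s v y" using G_kernel[OF yP] by blast
    have k0: "k \<noteq> 0" using k ab(1) by auto
    have "h' y l *v v y = (l - \<alpha>) *s v y" for l
    proof -
      have "k *s (h' y l *v v y) = k *s ((l - \<alpha>) *s v y)"
        using ab(2)[of l] unfolding k \<beta> vector_scalar_commute by (simp add: vec_eq_iff algebra_simps)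
      then show ?thesis using k0 by (simp only: vector_mul_lcancel) simp
    qed
    moreover have "cross2 (v y) b' \<noteq> 0" using ab(1) unfolding k by (simp add: cross2_smult)
    ultimately show ?thesis using ab(3) \<Omega>h \<beta> by blast
  qed
  obtain c where c: "c \<in> At" "x \<in> fst c" using chart_at by blast
  have xP: "x \<notin> P" using x Q_P by blast
  obtain b' where b': "cross2 (v x) b' \<noteq> 0" "\<And>l. h' x l *v v x = (l - \<alpha>) *s v x"
      "\<And>l. h' x l *v b' = b'" "\<And>l. l \<noteq> \<alpha> \<Longrightarrow> \<Omega> x l ** h' x l = G x l"
    using eig[OF x(2)] by blast
  define p where "p = cross2 (w c x) b' / cross2 (v x) b'"
  define q where "q = cross2 (v x) (w c x) / cross2 (v x) b'"
  have w: "w c x = p *s v x + q *s b'"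
    unfolding p_def q_def by (rule basis_decomposition[OF b'(1)])
  have hw: "h' x l *v w c x = w c x + (l - \<alpha> - 1) *s (p *s v x)" for l
    unfolding w matrix_vector_right_distrib vector_scalar_commute b'
    by (simp add: vec_eq_iff algebra_simps)
  have xQ': "x \<in> - Q'" using x by simp
  note r = chart[OF c(1)] Q'o c(2) xQ'
  have key: "maurer_cartan \<Omega> c x l *v v x = C c x *v v x + (w c x + (l - \<alpha> - 1) *s (p *s v x))" if l: "l \<noteq> \<alpha>" for l
  proof -
    have \<Omega>v: "\<Omega> y l *v v y = u y l" if "y \<notin> Q'" for y
    proof -
      have yP: "y \<notin> P" using that PQ' by auto
      have "(l - \<alpha>) *s (\<Omega> y l *v v y) = (l - \<alpha>) *s u y l"
        using eig[OF that] l mult_u[OF yP, of l]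
        by (metis matrix_vector_mul_assoc vector_scalar_commute)
      then show ?thesis using l by (simp only: vector_mul_lcancel) simp
    qed
    have H: "holo_mat c (- Q') (\<lambda>y. \<Omega> y l)" "holo_vec c (- Q') v"
      using mero_imp_holo(2)[OF mero_frame[OF fr c(1)]]
        holo_vec_subset[OF mero_imp_holo(1)[OF mero_v[OF c(1)]]] PQ' by auto
    have "\<Omega> x l *v (h' x l *v w c x) = G x l *v w c x"
      using b'(4)[OF l] by (simp add: matrix_vector_mul_assoc)
    also have "\<dots> = dz_vec c (\<lambda>y. \<Omega> y l *v v y) x"
      using dz_vec_cong[OF r, of "\<lambda>y. \<Omega> y l *v v y" "\<lambda>y. u y l"] dz_u_Q[OF c x(1)] \<Omega>v by simp
    also have "\<dots> = \<Omega> x l *v (maurer_cartan \<Omega> c x l *v v x - C c x *v v x)"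
      unfolding dz_vec_mult[OF r H] dz_frame[OF fr x(2)] dz_v[OF c xP]
      by (simp add: matrix_vector_mul_assoc[symmetric] matrix_vector_mult_diff_distrib 
           matrix_vector_mult_diff_distrib[of _ 0, simplified])
    finally have "h' x l *v w c x = maurer_cartan \<Omega> c x l *v v x - C c x *v v x"
      by (rule det_1_mult_cancel[OF det\<Omega>[OF x(2)]])
    then show ?thesis by (simp add: hw)
  qed
  have "lwr_potential At Q' (maurer_cartan \<Omega>)" using fr by (simp add: lwr_frame_def)
  then obtain A1 B1 where A1: "\<And>y. y \<in> fst c - Q' \<Longrightarrow> nilpotent_mat (A1 y)"
     "\<And>y l. y \<in> fst c - Q' \<Longrightarrow> maurer_cartan \<Omega> c y l = scale_mat l (A1 y) + B1 y"
    using c(1) unfolding lwr_potential_def by metis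
  have xc: "x \<in> fst c - Q'" using c x by simp
  \<comment> \<open>Two spectral values other than \<open>\<alpha>\<close> at distance one: the difference isolates the coefficient
    of \<open>l\<close> on both sides of \<open>key\<close>.\<close>
  have "maurer_cartan \<Omega> c x (\<alpha> + 2) *v v x - maurer_cartan \<Omega> c x (\<alpha> + 1) *v v x = p *s v x"
    by (simp add: key)
  moreover have "maurer_cartan \<Omega> c x (\<alpha> + 2) *v v x - maurer_cartan \<Omega> c x (\<alpha> + 1) *v v x = A1 x *v v x"
    unfolding A1(2)[OF xc] by (simp add: matrix_vector_mult_add_rdistrib scale_mat_mult_vec vec_eq_iff algebra_simps)
  ultimately have "A1 x *v v x = p *s v x" by simp
  then have "p = 0" using nilpotent_eigenvalue[OF A1(1)[OF xc]] v_nonzero[OF xP] by blast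
  show ?thesis
  proof
    fix l
    show "h' x l = h x l"
      using hw[of l] \<open>p = 0\<close>
      by (intro matrix_eq_on_basis[OF v_w_basis[OF c x(1)]])
         (simp_all only: b'(2) h_v[OF c x(1)] h_w[OF c x(1)], simp)
  qed
qed

end

theorem theorem8p3:
  fixes At :: "'a::t2_space chart set"
    and P :: "'a set"
    and \<Phi> :: "'a \<Rightarrow> complex \<Rightarrow> complex^2^2"
    and g :: "complex \<Rightarrow> complex^2^2"
  assumes "riemann_surface At"
    and "lwr_frame At P \<Phi>"
    and "\<not> lwr_flat At P \<Phi>"
    and "simple_factor g"
  shows "\<exists>Q h. z_dependent_simple_factor (- Q) h \<and> dresses_to_lwr_frame At P \<Phi> g Q h \<and>
           (\<forall>Q' h'. z_dependent_simple_factor (- Q') h' \<and> dresses_to_lwr_frame At P \<Phi> g Q' h' \<longrightarrow>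
              (\<forall>x \<in> - (Q \<union> Q'). h' x = h x))"
proof -
  obtain \<alpha> L M where "is_SF \<alpha> L M g" using assms(4) by (auto simp: simple_factor_def)
  then obtain v0 m0 where g: "cross2 v0 m0 \<noteq> 0" "\<And>l. g l *v v0 = (l - \<alpha>) *s v0" "\<And>l. g l *v m0 = m0"
    using is_SF_eigenbasis by blast
  have pot: "lwr_potential At P (maurer_cartan \<Phi>)" using assms(2) by (simp add: lwr_frame_def)
  have "\<forall>c\<in>At. \<exists>AB :: ('a \<Rightarrow> complex^2^2) \<times> ('a \<Rightarrow> complex^2^2). 
     mero_mat c P (fst AB) \<and> mero_mat c P (snd AB) \<and>
        (\<forall>x \<in> fst c - P. nilpotent_mat (fst AB x)) \<and>
        (\<forall>x \<in> fst c - P. \<forall>l. maurer_cartan \<Phi> c x l = scale_mat l (fst AB x) + snd AB x)"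
    using pot unfolding lwr_potential_def mero_mat_def mero_off_def by (simp only: split_paired_Ex fst_conv snd_conv) blast
  then obtain AB where AB: "\<And>c. c \<in> At \<Longrightarrow> mero_mat c P (fst (AB c)) \<and> mero_mat c P (snd (AB c)) \<and>
        (\<forall>x \<in> fst c - P. nilpotent_mat (fst (AB c) x)) \<and>
        (\<forall>x \<in> fst c - P. \<forall>l. maurer_cartan \<Phi> c x l = scale_mat l (fst (AB c) x) + snd (AB c) x)"
    by metis
  define A where "A = (\<lambda>c. fst (AB c))"
  define C where "C = (\<lambda>c x. scale_mat \<alpha> (A c x) + snd (AB c) x)"
  interpret lwr_dressing At P \<Phi> A C \<alpha> v0 m0 g
  proof
    fix c assume c: "c \<in> At"
    show "mero_mat c P (A c)" using AB[OF c] by (simp add: A_def)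
    then show "mero_mat c P (C c)" using AB[OF c] unfolding C_def mero_mat_def scale_mat_def
      by (auto intro!: mero_off_intros)
    fix x assume x: "x \<in> fst c" "x \<notin> P"
    show "nilpotent_mat (A c x)" using AB[OF c] x by (simp add: A_def)
    fix l
    have "maurer_cartan \<Phi> c x l = scale_mat l (A c x) + snd (AB c) x" using AB[OF c] x by (simp add: A_def)
    then show "maurer_cartan \<Phi> c x l = scale_mat (l - \<alpha>) (A c x) + C c x"
      by (simp add: C_def vec_eq_iff scale_mat_def algebra_simps)
  qed (fact assms g)+
  interpret lwr_dressing_generic At P \<Phi> A C \<alpha> v0 m0 g
    by unfold_locales (rule Q_sparse_of_not_flat[OF assms(3)])
  show ?thesis
  proof (intro exI conjI allI impI ballI)
    show "z_dependent_simple_factor (- Q) h" by (rule h_simple_factor)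
    show "dresses_to_lwr_frame At P \<Phi> g Q h" by (rule dresses_h)
    fix Q' h' x
    assume "z_dependent_simple_factor (- Q') h' \<and> dresses_to_lwr_frame At P \<Phi> g Q' h'" "x \<in> - (Q \<union> Q')"
    then show "h' x = h x" by (intro h_unique) auto
  qed
qed

end
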